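(* Let $R$ be a domain and let $G$ be a finite undirected graph without loops with vertex set $A=\{a_1,a_2,\dots,a_n\}$, where $n\geqslant 2$. Let $L(A;G)$ be one of the following Lie $R$-algebras: the partially commutative Lie algebra $\mathcal{L}(A;G)$, the partially commutative metabelian Lie algebra $\mathcal{M}(A;G)$, or the partially commutative nilpotent Lie algebra $\mathcal{N}_m(A;G)$ of degree $m\geqslant 2$. Then $L(A;G)$ splits into a direct sum $L(A;G)=L_1\oplus L_2$ of two non-zero subalgebras $L_1,L_2$ if and only if the complement graph $\overline{G}$ is not connected.
   Context: All Lie algebras are Lie algebras over the domain $R$. For vertices $a,b$ of $G$ write $a\leftrightarrow b$ if $\{a,b\}$ is an edge of $G$. The complement graph $\overline{G}$ has vertex set $A$, and distinct $a,b$ are adjacent in $\overline{G}$ iff they are not adjacent in $G$. For a variety $\mathfrak{M}$ of Lie $R$-algebras, the partially commutative Lie algebra in $\mathfrak{M}$ with defining graph $G$ is the Lie algebra presented in $\mathfrak{M}$ by generators $A$ and defining relations $[a_i,a_j]=0$ for all edges $\{a_i,a_j\}$ of $G$ (no other relations besides the identities of $\mathfrak{M}$). $\mathcal{L}(A;G)$ is obtained for $\mathfrak{M}$ the variety of all Lie algebras, $\mathcal{M}(A;G)$ for the variety of metabelian Lie algebras (identity $[[x,y],[z,t]]=0$), and $\mathcal{N}_m(A;G)$ for the variety of nilpotent Lie algebras of degree $m$ (all Lie products of $m+1$ elements vanish). A decomposition $L=L_1\oplus L_2$ into a direct sum of subalgebras means $L_1,L_2$ are subalgebras, $L$ is the direct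 sum of $L_1$ and $L_2$ as $R$-modules, and $[L_1,L_2]=0$. *)

theory Defs
  imports "HOL-Algebra.Ring"
begin

text \<open>Lie algebras over a commutative ring R (HOL-Algebra ring record).\<close>

record ('r, 'a) liealg =
  lcarrier :: "'a set"
  ladd :: "'a \<Rightarrow> 'a \<Rightarrow> 'a"
  lzero :: 'a
  lsmult :: "'r \<Rightarrow> 'a \<Rightarrow> 'a"
  lbr :: "'a \<Rightarrow> 'a \<Rightarrow> 'a"

definition lie_algebra :: "('r, 'b) ring_scheme \<Rightarrow> ('r, 'a) liealg \<Rightarrow> bool" where
  "lie_algebra R L \<longleftrightarrow>
     (let V = lcarrier L; p = ladd L; z = lzero L; s = lsmult L; b = lbr L in
      z \<in> V \<and>
      (\<forall>x\<in>V. \<forall>y\<in>V. p x y \<in> V) \<and>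
      (\<forall>x\<in>V. \<forall>y\<in>V. \<forall>w\<in>V. p (p x y) w = p x (p y w)) \<and>
      (\<forall>x\<in>V. \<forall>y\<in>V. p x y = p y x) \<and>
      (\<forall>x\<in>V. p z x = x) \<and>
      (\<forall>x\<in>V. \<exists>y\<in>V. p x y = z) \<and>
      (\<forall>r\<in>carrier R. \<forall>x\<in>V. s r x \<in> V) \<and>
      (\<forall>r\<in>carrier R. \<forall>x\<in>V. \<forall>y\<in>V. s r (p x y) = p (s r x) (s r y)) \<and>
      (\<forall>r\<in>carrier R. \<forall>t\<in>carrier R. \<forall>x\<in>V. s (r \<oplus>\<^bsub>R\<^esub> t) x = p (s r x) (s t x)) \<and>
      (\<forall>r\<in>carrier R. \<forall>t\<in>carrier R. \<forall>x\<in>V. s (r \<otimes>\<^bsub>R\<^esub> t) x = s r (s t x)) \<and>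
      (\<forall>x\<in>V. s \<one>\<^bsub>R\<^esub> x = x) \<and>
      (\<forall>x\<in>V. \<forall>y\<in>V. b x y \<in> V) \<and>
      (\<forall>x\<in>V. \<forall>y\<in>V. \<forall>w\<in>V. b (p x y) w = p (b x w) (b y w)) \<and>
      (\<forall>x\<in>V. \<forall>y\<in>V. \<forall>w\<in>V. b x (p y w) = p (b x y) (b x w)) \<and>
      (\<forall>r\<in>carrier R. \<forall>x\<in>V. \<forall>y\<in>V. b (s r x) y = s r (b x y)) \<and>
      (\<forall>r\<in>carrier R. \<forall>x\<in>V. \<forall>y\<in>V. b x (s r y) = s r (b x y)) \<and>
      (\<forall>x\<in>V. b x x = z) \<and>
      (\<forall>x\<in>V. \<forall>y\<in>V. \<forall>w\<in>V. p (p (b (b x y) w) (b (b y w) x)) (b (b w x) y) = z))"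

definition lie_subalgebra :: "('r, 'b) ring_scheme \<Rightarrow> ('r, 'a) liealg \<Rightarrow> 'a set \<Rightarrow> bool" where
  "lie_subalgebra R L S \<longleftrightarrow> S \<subseteq> lcarrier L \<and> lzero L \<in> S \<and>
     (\<forall>x\<in>S. \<forall>y\<in>S. ladd L x y \<in> S) \<and>
     (\<forall>r\<in>carrier R. \<forall>x\<in>S. lsmult L r x \<in> S) \<and>
     (\<forall>x\<in>S. \<forall>y\<in>S. lbr L x y \<in> S)"

definition lie_hom :: "('r, 'b) ring_scheme \<Rightarrow> ('r, 'a) liealg \<Rightarrow> ('r, 'c) liealg \<Rightarrow> ('a \<Rightarrow> 'c) \<Rightarrow> bool" where
  "lie_hom R L K h \<longleftrightarrow> (\<forall>x\<in>lcarrier L. h x \<in> lcarrier K) \<and>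
     (\<forall>x\<in>lcarrier L. \<forall>y\<in>lcarrier L. h (ladd L x y) = ladd K (h x) (h y)) \<and>
     (\<forall>r\<in>carrier R. \<forall>x\<in>lcarrier L. h (lsmult L r x) = lsmult K r (h x)) \<and>
     (\<forall>x\<in>lcarrier L. \<forall>y\<in>lcarrier L. h (lbr L x y) = lbr K (h x) (h y))"

text \<open>Lie products of k elements (all bracketings).\<close>
inductive lie_prod :: "('r, 'a) liealg \<Rightarrow> nat \<Rightarrow> 'a \<Rightarrow> bool" for L where
  single: "x \<in> lcarrier L \<Longrightarrow> lie_prod L 1 x"
| bracket: "lie_prod L i u \<Longrightarrow> lie_prod L j v \<Longrightarrow> lie_prod L (i + j) (lbr L u v)"

datatype variety = AllLie | Metabelian | Nilpotent nat

fun in_variety :: "('r, 'a) liealg \<Rightarrow> variety \<Rightarrow> bool" where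
  "in_variety L AllLie = True"
| "in_variety L Metabelian = (\<forall>x\<in>lcarrier L. \<forall>y\<in>lcarrier L. \<forall>z\<in>lcarrier L. \<forall>t\<in>lcarrier L.
      lbr L (lbr L x y) (lbr L z t) = lzero L)"
| "in_variety L (Nilpotent m) = (\<forall>x. lie_prod L (m + 1) x \<longrightarrow> x = lzero L)"

definition generated_by :: "('r, 'b) ring_scheme \<Rightarrow> ('r, 'a) liealg \<Rightarrow> 'a set \<Rightarrow> bool" where
  "generated_by R L X \<longleftrightarrow> lcarrier L = \<Inter>{S. lie_subalgebra R L S \<and> X \<subseteq> S}"

text \<open>L (with generator map \<iota> on A) is the Lie algebra presented in the variety v by generators A
  and relations [a,b]=0 for edges of E.  Universal property is tested against Lie algebras
  whose carrier lives in the type 'r list (large enough to contain a copy of the presented algebra,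
  see NOTES.md); uniqueness of the induced homomorphism follows from generation.\<close>
definition pc_lie_algebra ::
  "('r, 'b) ring_scheme \<Rightarrow> variety \<Rightarrow> 'v set \<Rightarrow> ('v \<Rightarrow> 'v \<Rightarrow> bool) \<Rightarrow> ('r, 'a) liealg \<Rightarrow> ('v \<Rightarrow> 'a) \<Rightarrow> bool" where
  "pc_lie_algebra R v A E L \<iota> \<longleftrightarrow>
     lie_algebra R L \<and> in_variety L v \<and>
     (\<forall>a\<in>A. \<iota> a \<in> lcarrier L) \<and>
     (\<forall>a\<in>A. \<forall>b\<in>A. E a b \<longrightarrow> lbr L (\<iota> a) (\<iota> b) = lzero L) \<and>
     generated_by R L (\<iota> ` A) \<and>
     (\<forall>(K :: ('r, 'r list) liealg) f.
        lie_algebra R K \<and> in_variety K v \<and> (\<forall>a\<in>A. f a \<in> lcarrier K) \<and>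
        (\<forall>a\<in>A. \<forall>b\<in>A. E a b \<longrightarrow> lbr K (f a) (f b) = lzero K) \<longrightarrow>
        (\<exists>h. lie_hom R L K h \<and> (\<forall>a\<in>A. h (\<iota> a) = f a)))"

definition direct_sum_decomp :: "('r, 'b) ring_scheme \<Rightarrow> ('r, 'a) liealg \<Rightarrow> 'a set \<Rightarrow> 'a set \<Rightarrow> bool" where
  "direct_sum_decomp R L L1 L2 \<longleftrightarrow>
     lie_subalgebra R L L1 \<and> lie_subalgebra R L L2 \<and>
     (\<forall>x\<in>lcarrier L. \<exists>y\<in>L1. \<exists>z\<in>L2. x = ladd L y z) \<and>
     L1 \<inter> L2 = {lzero L} \<and>
     (\<forall>y\<in>L1. \<forall>z\<in>L2. lbr L y z = lzero L)"

definition complement_graph :: "('v \<Rightarrow> 'v \<Rightarrow> bool) \<Rightarrow> 'v \<Rightarrow> 'v \<Rightarrow> bool" where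
  "complement_graph E a b \<longleftrightarrow> a \<noteq> b \<and> \<not> E a b"

definition graph_connected :: "'v set \<Rightarrow> ('v \<Rightarrow> 'v \<Rightarrow> bool) \<Rightarrow> bool" where
  "graph_connected V E \<longleftrightarrow> V \<noteq> {} \<and>
     (\<forall>a\<in>V. \<forall>b\<in>V. (a, b) \<in> {(x, y). x \<in> V \<and> y \<in> V \<and> E x y}\<^sup>*)"

end

theory Submission
  imports Defs
begin

text \<open>
  If the complement graph is disconnected, the generators split into two mutually commuting sets
  \<open>B\<close> and \<open>C\<close>. The subalgebras they generate commute and span \<open>L\<close>; they meet trivially because the
  endomorphism fixing \<open>B\<close> and killing \<open>C\<close> is the identity on one and zero on the other.

  Conversely let \<open>L = L1 \<oplus> L2\<close> with connected complement graph. For a non-edge \<open>{a, b}\<close>, the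
  homomorphism of \<open>L\<close> onto the Heisenberg algebra given by \<open>a\<close> and \<open>b\<close> shows that the coordinate vectors
  \<open>(x_a, x_b)\<close> and \<open>(y_a, y_b)\<close> are proportional whenever \<open>x\<close> is in \<open>L1\<close> and \<open>y\<close> is in \<open>L2\<close>. Together they
  span the plane, so over a domain both coordinates vanish on one of the summands. By connectedness
  it is the same summand for all vertices, say \<open>L1\<close>; so \<open>L1\<close> lies in the derived algebra
  of \<open>L\<close>, which is the sum of those of \<open>L1\<close> and \<open>L2\<close>, and therefore \<open>L1\<close> is perfect. A perfect subalgebra
  is zero: this is immediate in the nilpotent and metabelian cases, and in the free case
  it follows from the grading by degree, obtained from the homomorphism \<open>a \<mapsto> t a\<close>
  into power series over \<open>L\<close>.

  The universal property is only assumed for targets whose elements are lists of scalars; it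
  extends to all targets because the elements of a finitely generated Lie algebra are values of
  Lie terms, which can be encoded as such lists.
\<close>

section \<open>Lie algebras with explicit carrier\<close>

definition additive_group :: "('r, 'a) liealg \<Rightarrow> 'a ring" where
  "additive_group L = \<lparr>carrier = lcarrier L, mult = lbr L, one = lzero L, zero = lzero L, add = ladd L\<rparr>"

lemma additive_group_simps [simp]:
  "carrier (additive_group L) = lcarrier L"
  "zero (additive_group L) = lzero L"
  "add (additive_group L) = ladd L"
  by (simp_all add: additive_group_def)

locale lie_alg = R: cring R for R :: "('r, 'b) ring_scheme" (structure) +
  fixes L :: "('r, 'a) liealg"
  assumes lie: "lie_algebra R L"
begin

abbreviation "V \<equiv> lcarrier L"
abbreviation "nul \<equiv> lzero L"
abbreviation plus_L (infixl \<open>\<boxplus>\<close> 65) where "x \<boxplus> y \<equiv> ladd L x y"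
abbreviation smult_L (infixr \<open>\<odot>\<close> 70) where "r \<odot> x \<equiv> lsmult L r x"
abbreviation bracket_L (\<open>\<langle>_, _\<rangle>\<close>) where "\<langle>x, y\<rangle> \<equiv> lbr L x y"

lemma zero_closed [simp]: "nul \<in> V"
  and add_closed [simp]: "x \<in> V \<Longrightarrow> y \<in> V \<Longrightarrow> x \<boxplus> y \<in> V"
  and add_assoc: "x \<in> V \<Longrightarrow> y \<in> V \<Longrightarrow> w \<in> V \<Longrightarrow> x \<boxplus> y \<boxplus> w = x \<boxplus> (y \<boxplus> w)"
  and add_commute: "x \<in> V \<Longrightarrow> y \<in> V \<Longrightarrow> x \<boxplus> y = y \<boxplus> x"
  and add_zero_left [simp]: "x \<in> V \<Longrightarrow> nul \<boxplus> x = x"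
  and ex_add_inverse: "x \<in> V \<Longrightarrow> \<exists>y\<in>V. x \<boxplus> y = nul"
  and smult_closed [simp]: "r \<in> carrier R \<Longrightarrow> x \<in> V \<Longrightarrow> r \<odot> x \<in> V"
  and smult_add_right: "r \<in> carrier R \<Longrightarrow> x \<in> V \<Longrightarrow> y \<in> V \<Longrightarrow> r \<odot> (x \<boxplus> y) = r \<odot> x \<boxplus> r \<odot> y"
  and smult_add_left: "r \<in> carrier R \<Longrightarrow> t \<in> carrier R \<Longrightarrow> x \<in> V \<Longrightarrow> (r \<oplus> t) \<odot> x = r \<odot> x \<boxplus> t \<odot> x"
  and smult_assoc: "r \<in> carrier R \<Longrightarrow> t \<in> carrier R \<Longrightarrow> x \<in> V \<Longrightarrow> (r \<otimes> t) \<odot> x = r \<odot> t \<odot> x"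
  and smult_one [simp]: "x \<in> V \<Longrightarrow> \<one> \<odot> x = x"
  and bracket_closed [simp]: "x \<in> V \<Longrightarrow> y \<in> V \<Longrightarrow> \<langle>x, y\<rangle> \<in> V"
  and bracket_add_left: "x \<in> V \<Longrightarrow> y \<in> V \<Longrightarrow> w \<in> V \<Longrightarrow> \<langle>x \<boxplus> y, w\<rangle> = \<langle>x, w\<rangle> \<boxplus> \<langle>y, w\<rangle>"
  and bracket_add_right: "x \<in> V \<Longrightarrow> y \<in> V \<Longrightarrow> w \<in> V \<Longrightarrow> \<langle>x, y \<boxplus> w\<rangle> = \<langle>x, y\<rangle> \<boxplus> \<langle>x, w\<rangle>"
  and bracket_smult_left: "r \<in> carrier R \<Longrightarrow> x \<in> V \<Longrightarrow> y \<in> V \<Longrightarrow> \<langle>r \<odot> x, y\<rangle> = r \<odot> \<langle>x, y\<rangle>"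
  and bracket_smult_right: "r \<in> carrier R \<Longrightarrow> x \<in> V \<Longrightarrow> y \<in> V \<Longrightarrow> \<langle>x, r \<odot> y\<rangle> = r \<odot> \<langle>x, y\<rangle>"
  and bracket_self [simp]: "x \<in> V \<Longrightarrow> \<langle>x, x\<rangle> = nul"
  and jacobi: "x \<in> V \<Longrightarrow> y \<in> V \<Longrightarrow> w \<in> V \<Longrightarrow>
    \<langle>\<langle>x, y\<rangle>, w\<rangle> \<boxplus> \<langle>\<langle>y, w\<rangle>, x\<rangle> \<boxplus> \<langle>\<langle>w, x\<rangle>, y\<rangle> = nul"
  by (insert lie, unfold lie_algebra_def Let_def, meson+)

lemma abelian_group_L: "abelian_group (additive_group L)"
  by (rule abelian_groupI) (auto simp: add_assoc intro: add_commute dest: ex_add_inverse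
      | metis add_commute ex_add_inverse)+

sublocale G: abelian_group "additive_group L"
  rewrites "carrier (additive_group L) = lcarrier L"
    and "zero (additive_group L) = lzero L"
    and "add (additive_group L) = ladd L"
  using abelian_group_L by simp_all

lemma add_zero_right [simp]: "x \<in> V \<Longrightarrow> x \<boxplus> nul = x"
  by (rule G.r_zero)

lemma smult_zero_left [simp]: "x \<in> V \<Longrightarrow> \<zero> \<odot> x = nul"
  using smult_add_left[of \<zero> \<zero> x] G.add.l_cancel_one[of "\<zero> \<odot> x" "\<zero> \<odot> x"] by simp

lemma smult_zero_right [simp]: "r \<in> carrier R \<Longrightarrow> r \<odot> nul = nul"
  using smult_add_right[of r nul nul] G.add.l_cancel_one[of "r \<odot> nul" "r \<odot> nul"] by simp

lemma bracket_zero_left [simp]: "x \<in> V \<Longrightarrow> \<langle>nul, x\<rangle> = nul"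
  using bracket_smult_left[of \<zero> nul x] by simp

lemma bracket_zero_right [simp]: "x \<in> V \<Longrightarrow> \<langle>x, nul\<rangle> = nul"
  using bracket_smult_right[of \<zero> x nul] by simp

lemma add_minus_one [simp]: "x \<in> V \<Longrightarrow> x \<boxplus> (\<ominus> \<one>) \<odot> x = nul"
  using smult_add_left[of \<one> "\<ominus> \<one>" x] by (simp add: R.r_neg)

lemma bracket_anticommute:
  assumes "x \<in> V" "y \<in> V"
  shows "\<langle>x, y\<rangle> \<boxplus> \<langle>y, x\<rangle> = nul"
  using bracket_self[of "x \<boxplus> y"] assms
  by (simp add: bracket_add_left bracket_add_right del: bracket_self) (simp add: add_commute)

lemma bracket_eq_zero_commute:
  "x \<in> V \<Longrightarrow> y \<in> V \<Longrightarrow> \<langle>x, y\<rangle> = nul \<Longrightarrow> \<langle>y, x\<rangle> = nul"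
  using bracket_anticommute[of x y] by simp

subsection \<open>Finite sums\<close>

abbreviation "lsum \<equiv> finsum (additive_group L)"

lemma bracket_lsum_left:
  assumes "y \<in> V" "f \<in> I \<rightarrow> V" "finite I"
  shows "\<langle>lsum f I, y\<rangle> = lsum (\<lambda>i. \<langle>f i, y\<rangle>) I"
  using assms(3,2)
proof (induction I rule: finite_induct)
  case (insert i I)
  then have "f \<in> I \<rightarrow> V" "f i \<in> V" "(\<lambda>i. \<langle>f i, y\<rangle>) \<in> I \<rightarrow> V"
    using assms(1) by (auto simp: Pi_iff)
  then show ?case using insert assms(1) by (simp add: bracket_add_left G.finsum_closed)
qed (use assms(1) in simp)

lemma smult_lsum:
  assumes "r \<in> carrier R" "f \<in> I \<rightarrow> V" "finite I"
  shows "r \<odot> lsum f I = lsum (\<lambda>i. r \<odot> f i) I"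
  using assms(3,2)
proof (induction I rule: finite_induct)
  case (insert i I)
  then have "f \<in> I \<rightarrow> V" "f i \<in> V" "(\<lambda>i. r \<odot> f i) \<in> I \<rightarrow> V"
    using assms(1) by (auto simp: Pi_iff)
  then show ?case using insert assms(1) by (simp add: smult_add_right G.finsum_closed)
qed (use assms(1) in simp)

lemma lsum_Sigma:
  assumes "finite I" "\<And>i. i \<in> I \<Longrightarrow> finite (B i)" "\<And>i j. i \<in> I \<Longrightarrow> j \<in> B i \<Longrightarrow> f i j \<in> V"
  shows "lsum (\<lambda>i. lsum (f i) (B i)) I = lsum (\<lambda>(i, j). f i j) (Sigma I B)"
proof -
  have "lsum (\<lambda>(i, j). f i j) (\<Union>i\<in>I. Pair i ` B i) = lsum (\<lambda>i. lsum (\<lambda>(i, j). f i j) (Pair i ` B i)) I"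
    using assms by (intro G.add.finprod_UN_disjoint) (auto simp: pairwise_def disjnt_def)
  also have "\<dots> = lsum (\<lambda>i. lsum (f i) (B i)) I"
  proof (intro G.finsum_cong' refl)
    fix i assume "i \<in> I"
    then have "lsum (\<lambda>(i, j). f i j) (Pair i ` B i) = lsum (\<lambda>j. case (i, j) of (i, j) \<Rightarrow> f i j) (B i)"
      using assms by (intro G.finsum_reindex) (auto simp: inj_on_def)
    then show "lsum (\<lambda>(i, j). f i j) (Pair i ` B i) = lsum (f i) (B i)" by simp
  qed (use assms in \<open>auto intro!: G.finsum_closed\<close>)
  also have "(\<Union>i\<in>I. Pair i ` B i) = Sigma I B" by auto
  finally show ?thesis ..
qed

lemma lsum_eq_single:
  assumes "finite I" "k \<in> I" "g k \<in> V" "\<And>i. i \<in> I \<Longrightarrow> i \<noteq> k \<Longrightarrow> g i = nul"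
  shows "lsum g I = g k"
proof -
  have "lsum g I = lsum (\<lambda>j. if j = k then g j else nul) I"
    using assms by (intro G.finsum_cong') auto
  also have "\<dots> = g k"
    using assms by (intro G.add.finprod_singleton_swap) (auto simp: Pi_iff, metis zero_closed)
  finally show ?thesis .
qed


lemma add_add_swap:
  "a \<in> V \<Longrightarrow> b \<in> V \<Longrightarrow> c \<in> V \<Longrightarrow> d \<in> V \<Longrightarrow> (a \<boxplus> b) \<boxplus> (c \<boxplus> d) = (a \<boxplus> c) \<boxplus> (b \<boxplus> d)"
  by (simp add: G.a_ac)

end

section \<open>Spans, generated subalgebras and homomorphisms\<close>

inductive_set modspan :: "('r, 'b) ring_scheme \<Rightarrow> ('r, 'a) liealg \<Rightarrow> 'a set \<Rightarrow> 'a set"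
  for R L X where
  zero: "lzero L \<in> modspan R L X"
| base: "x \<in> X \<Longrightarrow> x \<in> modspan R L X"
| add: "x \<in> modspan R L X \<Longrightarrow> y \<in> modspan R L X \<Longrightarrow> ladd L x y \<in> modspan R L X"
| smult: "r \<in> carrier R \<Longrightarrow> x \<in> modspan R L X \<Longrightarrow> lsmult L r x \<in> modspan R L X"

definition brackets :: "('r, 'a) liealg \<Rightarrow> 'a set \<Rightarrow> 'a set \<Rightarrow> 'a set" where
  "brackets L X Y = {lbr L x y |x y. x \<in> X \<and> y \<in> Y}"

definition subalgebra_generated :: "('r, 'b) ring_scheme \<Rightarrow> ('r, 'a) liealg \<Rightarrow> 'a set \<Rightarrow> 'a set" where
  "subalgebra_generated R L X = \<Inter>{S. lie_subalgebra R L S \<and> X \<subseteq> S}"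

lemma generated_by_induct:
  "generated_by R L X \<Longrightarrow> lie_subalgebra R L S \<Longrightarrow> X \<subseteq> S \<Longrightarrow> lcarrier L \<subseteq> S"
  unfolding generated_by_def by blast

lemma subalgebra_generated_minimal:
  "lie_subalgebra R L S \<Longrightarrow> X \<subseteq> S \<Longrightarrow> subalgebra_generated R L X \<subseteq> S"
  unfolding subalgebra_generated_def by blast

lemma subset_subalgebra_generated: "X \<subseteq> subalgebra_generated R L X"
  unfolding subalgebra_generated_def by blast

context lie_alg
begin

abbreviation "span \<equiv> modspan R L"

lemma lie_subalgebra_carrier: "lie_subalgebra R L V"
  unfolding lie_subalgebra_def by auto

lemma lie_subalgebra_generated:
  assumes "X \<subseteq> V"
  shows "lie_subalgebra R L (subalgebra_generated R L X)"
proof -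
  have "subalgebra_generated R L X \<subseteq> V"
    using assms lie_subalgebra_carrier by (rule subalgebra_generated_minimal[rotated])
  then show ?thesis
    unfolding lie_subalgebra_def by (auto simp: subalgebra_generated_def lie_subalgebra_def)
qed

lemma span_minimal:
  assumes "X \<subseteq> S" "nul \<in> S" "\<And>x y. x \<in> S \<Longrightarrow> y \<in> S \<Longrightarrow> x \<boxplus> y \<in> S"
    and "\<And>r x. r \<in> carrier R \<Longrightarrow> x \<in> S \<Longrightarrow> r \<odot> x \<in> S"
  shows "span X \<subseteq> S"
proof
  fix x assume "x \<in> span X"
  then show "x \<in> S" by induction (use assms in auto)
qed

lemma span_closed: "X \<subseteq> V \<Longrightarrow> span X \<subseteq> V"
  by (rule span_minimal) auto

lemma span_mono: "X \<subseteq> Y \<Longrightarrow> span X \<subseteq> span Y"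
  by (rule span_minimal) (auto intro: modspan.intros)

lemma span_subset_subalgebra: "lie_subalgebra R L S \<Longrightarrow> X \<subseteq> S \<Longrightarrow> span X \<subseteq> S"
  by (rule span_minimal) (auto simp: lie_subalgebra_def)

lemma brackets_closed: "X \<subseteq> V \<Longrightarrow> Y \<subseteq> V \<Longrightarrow> brackets L X Y \<subseteq> V"
  unfolding brackets_def by (auto simp: subset_iff)

lemma bracket_in_span_brackets:
  assumes "X \<subseteq> V" "Y \<subseteq> V" "x \<in> span X" "y \<in> span Y"
  shows "\<langle>x, y\<rangle> \<in> span (brackets L X Y)"
proof -
  note XV = span_closed[OF assms(1)] and YV = span_closed[OF assms(2)]
  have 1: "\<langle>x, y\<rangle> \<in> span (brackets L X Y)" if "x \<in> X" for x
    using assms(4)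
  proof induction
    case zero
    have "x \<in> V" using that assms by auto
    then show ?case by (simp add: modspan.zero)
  next
    case (base y)
    then show ?case using that by (auto simp: brackets_def intro: modspan.base)
  next
    case (add y z)
    then have "x \<in> V" "y \<in> V" "z \<in> V" using that assms YV by auto
    with add show ?case by (simp add: bracket_add_right modspan.add)
  next
    case (smult r y)
    then have "x \<in> V" "y \<in> V" using that assms YV by auto
    with smult show ?case by (simp add: bracket_smult_right modspan.smult)
  qed
  have y: "y \<in> V" using assms YV by auto
  from assms(3) show ?thesis
  proof induction
    case zero
    then show ?case using y by (auto intro: modspan.zero)
  next
    case (base y)
    then show ?case using 1 by simp
  next
    case (add x z)
    then have "x \<in> V" "z \<in> V" using XV by auto
    with add y show ?case by (simp add: bracket_add_left modspan.add)
  next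
    case (smult r x)
    then have "x \<in> V" using XV by auto
    with smult y show ?case by (simp add: bracket_smult_left modspan.smult)
  qed
qed

lemma span_insert_decompose:
  assumes "y \<in> V" "X \<subseteq> V" "x \<in> span (insert y X)"
  shows "\<exists>r\<in>carrier R. \<exists>z\<in>span X. x = r \<odot> y \<boxplus> z"
  using assms(3)
proof induction
  case zero
  then show ?case using assms by (intro bexI[of _ \<zero>] bexI[of _ nul]) (auto intro: modspan.zero)
next
  case (base x)
  then show ?case
  proof
    assume "x = y"
    then show ?thesis using assms by (intro bexI[of _ \<one>] bexI[of _ nul]) (auto intro: modspan.zero)
  next
    assume "x \<in> X"
    then show ?thesis using assms by (intro bexI[of _ \<zero>] bexI[of _ x]) (auto intro: modspan.base)
  qed
next
  case (add x x')
  then obtain r z r' z' where *: "r \<in> carrier R" "r' \<in> carrier R" "z \<in> span X" "z' \<in> span X"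
    "x = r \<odot> y \<boxplus> z" "x' = r' \<odot> y \<boxplus> z'" by blast
  then have "z \<in> V" "z' \<in> V" using span_closed assms by auto
  with * assms have "x \<boxplus> x' = (r \<oplus> r') \<odot> y \<boxplus> (z \<boxplus> z')"
    by (simp add: add_add_swap smult_add_left)
  then show ?case using * by (blast intro: modspan.add)
next
  case (smult s x)
  then obtain r z where *: "r \<in> carrier R" "z \<in> span X" "x = r \<odot> y \<boxplus> z" by blast
  then have "z \<in> V" using span_closed assms by auto
  with * assms smult have "s \<odot> x = (s \<otimes> r) \<odot> y \<boxplus> s \<odot> z"
    by (simp add: smult_add_right smult_assoc)
  then show ?case using * smult by (blast intro: modspan.smult)
qed

lemma lie_hom_zero:
  assumes "lie_algebra R K" "lie_hom R L K h"
  shows "h nul = lzero K"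
proof -
  interpret K: lie_alg R K by unfold_locales fact
  have "h (nul \<boxplus> nul) = ladd K (h nul) (h nul)" and *: "h nul \<in> lcarrier K"
    using assms(2) zero_closed unfolding lie_hom_def by blast+
  then have "ladd K (h nul) (h nul) = h nul" by simp
  then show ?thesis using * K.G.add.l_cancel_one[of "h nul" "h nul"] by simp
qed

lemma lie_hom_eq_on_generators:
  assumes K: "lie_algebra R K" and h: "lie_hom R L K h" "lie_hom R L K g"
    and gen: "generated_by R L X" "X \<subseteq> V" "\<And>x. x \<in> X \<Longrightarrow> h x = g x" and x: "x \<in> V"
  shows "h x = g x"
proof -
  have "lie_subalgebra R L {x \<in> V. h x = g x}"
    using h lie_hom_zero[OF K h(1)] lie_hom_zero[OF K h(2)]
    unfolding lie_subalgebra_def lie_hom_def by simp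
  from generated_by_induct[OF gen(1) this] gen(2,3) x show ?thesis by auto
qed

end

lemma lie_prod_carrier:
  assumes "lie_alg R L" "lie_prod L n x"
  shows "x \<in> lcarrier L"
  using assms(2) by induction (auto simp: lie_alg.bracket_closed[OF assms(1)])

lemma lie_prod_pos: "lie_prod L n x \<Longrightarrow> n \<ge> 1"
  by (induction rule: lie_prod.induct) auto

lemma lie_prod_hom:
  assumes "lie_alg R L" "lie_hom R L K h" "lie_prod L n x"
  shows "lie_prod K n (h x)"
  using assms(3)
proof induction
  case (single x)
  then show ?case using assms(2) lie_prod.single[of "h x" K] by (auto simp: lie_hom_def)
next
  case (bracket i u j v)
  then have "h (lbr L u v) = lbr K (h u) (h v)"
    using assms(2) lie_prod_carrier[OF assms(1)] by (auto simp: lie_hom_def)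
  then show ?case using bracket lie_prod.bracket by metis
qed

context lie_alg
begin

lemma perfect_in_span_lie_prod:
  assumes S: "lie_subalgebra R L S" "S \<subseteq> span (brackets L S S)"
  shows "S \<subseteq> span {x. lie_prod L (Suc k) x}"
proof (induction k)
  case 0
  have "S \<subseteq> {x. lie_prod L 1 x}" using S(1) by (auto simp: lie_subalgebra_def intro!: lie_prod.single[simplified])
  then show ?case by (auto intro: modspan.base)
next
  case (Suc k)
  let ?P = "\<lambda>k. {x. lie_prod L k x}"
  have SV: "S \<subseteq> V" using S(1) by (simp add: lie_subalgebra_def)
  have PV: "?P k \<subseteq> V" for k using lie_prod_carrier[OF lie_alg_axioms] by auto
  have "brackets L (?P (Suc k)) V \<subseteq> ?P (Suc (Suc k))"
  proof
    fix z assume "z \<in> brackets L (?P (Suc k)) V"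
    then obtain x y where "lie_prod L (Suc k) x" "y \<in> V" "z = \<langle>x, y\<rangle>" by (auto simp: brackets_def)
    then show "z \<in> ?P (Suc (Suc k))"
      using lie_prod.bracket[of L "Suc k" x 1 y] lie_prod.single[of y L] by simp
  qed
  then have *: "span (brackets L (?P (Suc k)) V) \<subseteq> span (?P (Suc (Suc k)))" by (rule span_mono)
  have "brackets L S S \<subseteq> span (?P (Suc (Suc k)))"
  proof
    fix z assume "z \<in> brackets L S S"
    then obtain x y where "x \<in> S" "y \<in> S" "z = \<langle>x, y\<rangle>" by (auto simp: brackets_def)
    then show "z \<in> span (?P (Suc (Suc k)))"
      using bracket_in_span_brackets[OF PV subset_refl, of x "Suc k" y] Suc SV * by (auto intro: modspan.base)
  qed
  then have "span (brackets L S S) \<subseteq> span (?P (Suc (Suc k)))"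
    by (rule span_minimal) (auto intro: modspan.intros)
  then show ?case using S(2) by blast
qed

lemma direct_sum_decompD:
  assumes "direct_sum_decomp R L L1 L2"
  shows "lie_subalgebra R L L1" "lie_subalgebra R L L2" "L1 \<subseteq> V" "L2 \<subseteq> V" "L1 \<inter> L2 = {nul}"
    and "x \<in> V \<Longrightarrow> \<exists>y\<in>L1. \<exists>z\<in>L2. x = y \<boxplus> z"
    and "y \<in> L1 \<Longrightarrow> z \<in> L2 \<Longrightarrow> \<langle>y, z\<rangle> = nul"
  using assms unfolding direct_sum_decomp_def lie_subalgebra_def by metis+

lemma direct_sum_decomp_commute:
  assumes "direct_sum_decomp R L L1 L2"
  shows "direct_sum_decomp R L L2 L1"
  unfolding direct_sum_decomp_def
proof (intro conjI ballI)
  note dec = direct_sum_decompD[OF assms]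
  show "lie_subalgebra R L L2" "lie_subalgebra R L L1" by (rule dec)+
  show "L2 \<inter> L1 = {nul}" using dec(5) by (simp only: Int_commute)
  show "\<exists>y\<in>L2. \<exists>z\<in>L1. x = y \<boxplus> z" if x: "x \<in> V" for x
  proof -
    obtain y z where yz: "y \<in> L1" "z \<in> L2" "x = y \<boxplus> z" using dec(6)[OF x] by blast
    have "y \<boxplus> z = z \<boxplus> y" by (intro add_commute dec(3,4)[THEN subsetD] yz)
    then show ?thesis using yz by (intro bexI) simp_all
  qed
  show "\<langle>y, z\<rangle> = nul" if "y \<in> L2" "z \<in> L1" for y z
    by (intro bracket_eq_zero_commute[of z y] dec(7) dec(3,4)[THEN subsetD] that)
qed

lemma centralizer_subalgebra:
  assumes X: "X \<subseteq> V"
  shows "lie_subalgebra R L {y \<in> V. \<forall>x\<in>X. \<langle>y, x\<rangle> = nul}"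
proof -
  have "\<langle>\<langle>y, z\<rangle>, x\<rangle> = nul" if V: "x \<in> V" "y \<in> V" "z \<in> V" and "\<langle>y, x\<rangle> = nul" "\<langle>z, x\<rangle> = nul" for x y z
  proof -
    have "\<langle>x, y\<rangle> = nul" using that bracket_eq_zero_commute[of y x] by simp
    then show ?thesis using jacobi[of y z x] that by simp
  qed
  then show ?thesis
    using X unfolding lie_subalgebra_def
    by (auto simp: bracket_add_left bracket_smult_left subset_iff)
qed

end

text \<open>The hypotheses about \<^term>\<open>d\<close> say that \<^term>\<open>K'\<close> is isomorphic to a subalgebra of \<^term>\<open>K\<close>.\<close>

lemma
  fixes K :: "('r, 'c) liealg" and K' :: "('r, 'd) liealg"
  assumes R: "cring R" and K: "lie_algebra R K"
    and d: "lie_hom R K' K d" "inj_on d (lcarrier K')" "d (lzero K') = lzero K"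
    and closed: "lzero K' \<in> lcarrier K'"
      "\<And>x y. x \<in> lcarrier K' \<Longrightarrow> y \<in> lcarrier K' \<Longrightarrow> ladd K' x y \<in> lcarrier K'"
      "\<And>r x. r \<in> carrier R \<Longrightarrow> x \<in> lcarrier K' \<Longrightarrow> lsmult K' r x \<in> lcarrier K'"
      "\<And>x y. x \<in> lcarrier K' \<Longrightarrow> y \<in> lcarrier K' \<Longrightarrow> lbr K' x y \<in> lcarrier K'"
  shows lie_algebra_embedded: "lie_algebra R K'"
    and in_variety_embedded: "in_variety K v \<Longrightarrow> in_variety K' v"
proof -
  interpret K: lie_alg R K using R K by (intro lie_alg.intro lie_alg_axioms.intro)
  have [simp]: "x \<in> lcarrier K' \<Longrightarrow> d x \<in> lcarrier K"
    "x \<in> lcarrier K' \<Longrightarrow> y \<in> lcarrier K' \<Longrightarrow> d (ladd K' x y) = ladd K (d x) (d y)"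
    "r \<in> carrier R \<Longrightarrow> x \<in> lcarrier K' \<Longrightarrow> d (lsmult K' r x) = lsmult K r (d x)"
    "x \<in> lcarrier K' \<Longrightarrow> y \<in> lcarrier K' \<Longrightarrow> d (lbr K' x y) = lbr K (d x) (d y)" for x y r
    using d(1) unfolding lie_hom_def by auto
  note [simp] = closed d(3)
  have eq: "x = y" if "d x = d y" "x \<in> lcarrier K'" "y \<in> lcarrier K'" for x y
    using that d(2) by (auto dest: inj_onD)
  have inverse: "\<exists>y\<in>lcarrier K'. ladd K' x y = lzero K'" if "x \<in> lcarrier K'" for x
    using that by (intro bexI[of _ "lsmult K' (\<ominus>\<^bsub>R\<^esub> \<one>\<^bsub>R\<^esub>) x"] eq) simp_all
  show lie: "lie_algebra R K'"
    unfolding lie_algebra_def Let_def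
    by (intro conjI ballI inverse eq closed,
      simp_all add: K.smult_add_left K.smult_add_right K.smult_assoc K.bracket_add_left
        K.bracket_add_right K.bracket_smult_left K.bracket_smult_right K.jacobi,
      simp add: K.add_assoc, simp add: K.add_commute)
  then have K': "lie_alg R K'" using R by (intro lie_alg.intro lie_alg_axioms.intro)
  show "in_variety K' v" if "in_variety K v"
  proof (cases v)
    case Metabelian
    then show ?thesis using that by (auto intro!: eq)
  next
    case (Nilpotent m)
    then show ?thesis
      using that lie_prod_hom[OF K' d(1)] lie_prod_carrier[OF K'] by (auto intro!: eq)
  qed simp
qed

section \<open>The universal property for targets of arbitrary type\<close>

datatype 'r lie_term =
  Gen nat | Add "'r lie_term" "'r lie_term" | Smult 'r "'r lie_term" | Br "'r lie_term" "'r lie_term"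

fun valid_term :: "('r, 'b) ring_scheme \<Rightarrow> nat \<Rightarrow> 'r lie_term \<Rightarrow> bool" where
  "valid_term R n (Gen k) \<longleftrightarrow> k < n"
| "valid_term R n (Add s t) \<longleftrightarrow> valid_term R n s \<and> valid_term R n t"
| "valid_term R n (Smult r t) \<longleftrightarrow> r \<in> carrier R \<and> valid_term R n t"
| "valid_term R n (Br s t) \<longleftrightarrow> valid_term R n s \<and> valid_term R n t"

fun eval_term :: "('r, 'c) liealg \<Rightarrow> (nat \<Rightarrow> 'c) \<Rightarrow> 'r lie_term \<Rightarrow> 'c" where
  "eval_term K g (Gen k) = g k"
| "eval_term K g (Add s t) = ladd K (eval_term K g s) (eval_term K g t)"
| "eval_term K g (Smult r t) = lsmult K r (eval_term K g t)"
| "eval_term K g (Br s t) = lbr K (eval_term K g s) (eval_term K g t)"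

fun encode_term :: "'r \<Rightarrow> 'r \<Rightarrow> 'r lie_term \<Rightarrow> 'r list" where
  "encode_term p q (Gen k) = p # p # replicate k q @ [p]"
| "encode_term p q (Add s t) = p # q # encode_term p q s @ encode_term p q t"
| "encode_term p q (Smult r t) = q # p # r # encode_term p q t"
| "encode_term p q (Br s t) = q # q # encode_term p q s @ encode_term p q t"

lemma replicate_append_inject:
  "p \<noteq> q \<Longrightarrow> replicate k q @ p # xs = replicate l q @ p # ys \<Longrightarrow> k = l \<and> xs = ys"
proof (induction k arbitrary: l)
  case 0
  then show ?case by (cases l) auto
next
  case (Suc k)
  then show ?case by (cases l) auto
qed

text \<open>The code is prefix-free, which is what makes the induction work.\<close>

lemma encode_term_append_inject:
  assumes "p \<noteq> q"
  shows "encode_term p q s @ xs = encode_term p q t @ ys \<Longrightarrow> s = t \<and> xs = ys"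
proof (induction s arbitrary: t xs ys)
  case (Gen k)
  then show ?case using assms by (cases t) (auto dest: replicate_append_inject)
next
  case (Add s1 s2)
  obtain t1 t2 where t: "t = Add t1 t2"
    using Add.prems assms by (cases t) auto
  then have "encode_term p q s1 @ (encode_term p q s2 @ xs) = encode_term p q t1 @ (encode_term p q t2 @ ys)"
    using Add.prems by simp
  from Add.IH(1)[OF this] Add.IH(2) t show ?case by auto
next
  case (Smult r s)
  then show ?case using assms by (cases t) (auto simp del: append_eq_append_conv)
next
  case (Br s1 s2)
  obtain t1 t2 where t: "t = Br t1 t2"
    using Br.prems assms by (cases t) auto
  then have "encode_term p q s1 @ (encode_term p q s2 @ xs) = encode_term p q t1 @ (encode_term p q t2 @ ys)"
    using Br.prems by simp
  from Br.IH(1)[OF this] Br.IH(2) t show ?case by auto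
qed

lemma inj_encode_term: "p \<noteq> q \<Longrightarrow> inj (encode_term p q)"
  by (rule injI) (metis append_Nil2 encode_term_append_inject)

lemma finitely_generated_embeds_in_lists:
  fixes R :: "('r, 'b) ring_scheme" and K :: "('r, 'c) liealg" and n :: nat
  assumes R: "domain R" and K: "lie_algebra R K" and n: "0 < n"
    and g: "\<And>k. k < n \<Longrightarrow> g k \<in> lcarrier K"
  obtains K' :: "('r, 'r list) liealg" and d
  where "lie_algebra R K'" "\<And>v. in_variety K v \<Longrightarrow> in_variety K' v" "lie_hom R K' K d"
    "inj_on d (lcarrier K')" "\<And>k. k < n \<Longrightarrow> g k \<in> d ` lcarrier K'"
proof -
  interpret R: domain R by fact
  interpret K: lie_alg R K by unfold_locales fact
  define S where "S = eval_term K g ` {t. valid_term R n t}"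
  define e where "e x = encode_term \<zero>\<^bsub>R\<^esub> \<one>\<^bsub>R\<^esub> (SOME t. valid_term R n t \<and> eval_term K g t = x)" for x
  define d where "d = inv_into S e"
  have "inj_on e S"
  proof (rule inj_onI)
    fix x y assume "x \<in> S" "y \<in> S" "e x = e y"
    then have "(SOME t. valid_term R n t \<and> eval_term K g t = x) = (SOME t. valid_term R n t \<and> eval_term K g t = y)"
      using inj_encode_term[of "\<zero>\<^bsub>R\<^esub>" "\<one>\<^bsub>R\<^esub>"] by (auto simp: e_def inj_def)
    moreover have "eval_term K g (SOME t. valid_term R n t \<and> eval_term K g t = z) = z" if "z \<in> S" for z
      by (rule someI2_ex[where Q = "\<lambda>t. eval_term K g t = z"]) (use that in \<open>auto simp: S_def\<close>)
    ultimately show "x = y" using \<open>x \<in> S\<close> \<open>y \<in> S\<close> by metis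
  qed
  have de [simp]: "d (e x) = x" if "x \<in> S" for x
    using that \<open>inj_on e S\<close> by (simp add: d_def)
  have gS: "g k \<in> S" if "k < n" for k
    using that unfolding S_def by (intro image_eqI[of _ _ "Gen k"]) auto
  have addS: "ladd K x y \<in> S" if "x \<in> S" "y \<in> S" for x y
  proof -
    from that obtain s t where "valid_term R n (Add s t)" "ladd K x y = eval_term K g (Add s t)"
      by (auto simp: S_def)
    then show ?thesis unfolding S_def by blast
  qed
  have smS: "lsmult K r x \<in> S" if "r \<in> carrier R" "x \<in> S" for r x
  proof -
    from that obtain t where "valid_term R n (Smult r t)" "lsmult K r x = eval_term K g (Smult r t)"
      by (auto simp: S_def)
    then show ?thesis unfolding S_def by blast
  qed
  have brS: "lbr K x y \<in> S" if "x \<in> S" "y \<in> S" for x y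
  proof -
    from that obtain s t where "valid_term R n (Br s t)" "lbr K x y = eval_term K g (Br s t)"
      by (auto simp: S_def)
    then show ?thesis unfolding S_def by blast
  qed
  have zS: "lzero K \<in> S" using smS[OF R.zero_closed gS[OF n]] g[OF n] by simp
  have SK: "x \<in> lcarrier K" if "x \<in> S" for x
  proof -
    have "eval_term K g t \<in> lcarrier K" if "valid_term R n t" for t
      using that by (induction t) (auto intro: g)
    then show ?thesis using that by (auto simp: S_def)
  qed
  define K' :: "('r, 'r list) liealg" where "K' = \<lparr>lcarrier = e ` S, ladd = \<lambda>x y. e (ladd K (d x) (d y)),
    lzero = e (lzero K), lsmult = \<lambda>r x. e (lsmult K r (d x)), lbr = \<lambda>x y. e (lbr K (d x) (d y))\<rparr>"
  have hom: "lie_hom R K' K d"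
    unfolding lie_hom_def K'_def by (auto simp: addS smS brS SK)
  have inj: "inj_on d (lcarrier K')"
    unfolding K'_def by (auto simp: inj_on_def)
  have zero: "d (lzero K') = lzero K" by (simp add: K'_def zS)
  have closed: "lzero K' \<in> lcarrier K'"
      "\<And>x y. x \<in> lcarrier K' \<Longrightarrow> y \<in> lcarrier K' \<Longrightarrow> ladd K' x y \<in> lcarrier K'"
      "\<And>r x. r \<in> carrier R \<Longrightarrow> x \<in> lcarrier K' \<Longrightarrow> lsmult K' r x \<in> lcarrier K'"
      "\<And>x y. x \<in> lcarrier K' \<Longrightarrow> y \<in> lcarrier K' \<Longrightarrow> lbr K' x y \<in> lcarrier K'"
    unfolding K'_def by (auto simp: addS smS brS zS)
  show thesis
  proof (rule that[OF _ _ hom inj])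
    show "lie_algebra R K'"
      by (rule lie_algebra_embedded[OF R.is_cring K hom inj zero closed])
    show "in_variety K' v" if "in_variety K v" for v
      by (rule in_variety_embedded[OF R.is_cring K hom inj zero closed that])
    show "g k \<in> d ` lcarrier K'" if "k < n" for k
      using gS[OF that] by (intro image_eqI[of _ _ "e (g k)"]) (auto simp: K'_def)
  qed
qed

lemma pc_lie_algebra_universal:
  fixes R :: "('r, 'b) ring_scheme" and K :: "('r, 'c) liealg"
  assumes R: "domain R" and A: "finite A" "A \<noteq> {}"
    and pc: "pc_lie_algebra R v A E L \<iota>"
    and K: "lie_algebra R K" "in_variety K v" "\<And>a. a \<in> A \<Longrightarrow> f a \<in> lcarrier K"
      "\<And>a b. a \<in> A \<Longrightarrow> b \<in> A \<Longrightarrow> E a b \<Longrightarrow> lbr K (f a) (f b) = lzero K"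
  obtains h where "lie_hom R L K h" "\<And>a. a \<in> A \<Longrightarrow> h (\<iota> a) = f a"
proof -
  interpret R: domain R by fact
  obtain n :: nat and u where u: "A = u ` {i. i < n}"
    using A(1) by (auto simp: finite_conv_nat_seg_image)
  have "0 < n" using A(2) u by auto
  moreover have "(f \<circ> u) k \<in> lcarrier K" if "k < n" for k
    using K(3) u that by auto
  ultimately obtain K' :: "('r, 'r list) liealg" and d where K': "lie_algebra R K'" "in_variety K' v"
    and d: "lie_hom R K' K d" "inj_on d (lcarrier K')"
    and gen: "\<And>k. k < n \<Longrightarrow> (f \<circ> u) k \<in> d ` lcarrier K'"
    using finitely_generated_embeds_in_lists[OF R K(1), of n "f \<circ> u"] K(2) by metis
  interpret K': lie_alg R K' using K' by unfold_locales
  define f' where "f' a = inv_into (lcarrier K') d (f a)" for a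
  have fim: "f a \<in> d ` lcarrier K'" if "a \<in> A" for a
    using that gen u by auto
  have f'K: "f' a \<in> lcarrier K'" and df': "d (f' a) = f a" if "a \<in> A" for a
    using fim[OF that] by (auto simp: f'_def inv_into_into f_inv_into_f)
  have rel: "lbr K' (f' a) (f' b) = lzero K'" if "a \<in> A" "b \<in> A" "E a b" for a b
  proof (rule inj_onD[OF d(2)])
    show "d (lbr K' (f' a) (f' b)) = d (lzero K')"
      using d(1) f'K df' that K(4) K'.lie_hom_zero[OF K(1) d(1)] by (simp add: lie_hom_def)
  qed (use f'K that in auto)
  obtain h where h: "lie_hom R L K' h" "\<forall>a\<in>A. h (\<iota> a) = f' a"
    using pc K' f'K rel unfolding pc_lie_algebra_def by metis
  show thesis
  proof (rule that[of "d \<circ> h"])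
    show "lie_hom R L K (d \<circ> h)"
      using h(1) d(1) unfolding lie_hom_def by simp
  qed (use h df' in auto)
qed

section \<open>Coordinates and the Heisenberg algebra\<close>

lemma in_variety_class_two:
  assumes K: "lie_alg R K"
    and zero: "\<And>x y z. x \<in> lcarrier K \<Longrightarrow> y \<in> lcarrier K \<Longrightarrow> z \<in> lcarrier K \<Longrightarrow> lbr K (lbr K x y) z = lzero K"
    and v: "v = AllLie \<or> v = Metabelian \<or> (\<exists>m\<ge>2. v = Nilpotent m)"
  shows "in_variety K v"
proof -
  interpret K: lie_alg R K by fact
  have prod: "(n \<ge> 2 \<longrightarrow> (\<exists>y\<in>lcarrier K. \<exists>z\<in>lcarrier K. x = lbr K y z)) \<and> (n \<ge> 3 \<longrightarrow> x = lzero K)"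
    if "lie_prod K n x" for n x
    using that
  proof induction
    case (bracket i u j w)
    have uw: "u \<in> lcarrier K" "w \<in> lcarrier K" and ij: "i \<ge> 1" "j \<ge> 1"
      using bracket lie_prod_carrier[OF K] lie_prod_pos by auto
    have "lbr K u w = lzero K" if "i \<ge> 2 \<or> j \<ge> 2"
      using that
    proof
      assume "i \<ge> 2"
      then show ?thesis using bracket zero uw by auto
    next
      assume "j \<ge> 2"
      then have "lbr K w u = lzero K" using bracket zero uw by auto
      then show ?thesis using K.bracket_eq_zero_commute uw by blast
    qed
    then show ?case using uw ij by fastforce
  qed simp
  show ?thesis
    using v
  proof (elim disjE exE conjE)
    fix m :: nat assume "m \<ge> 2" "v = Nilpotent m"
    then show ?thesis using prod[of "m + 1"] by auto
  qed (auto simp: zero)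
qed

definition abelian_line :: "('r, 'b) ring_scheme \<Rightarrow> ('r, 'r) liealg" where
  "abelian_line R = \<lparr>lcarrier = carrier R, ladd = add R, lzero = \<zero>\<^bsub>R\<^esub>, lsmult = mult R,
    lbr = \<lambda>_ _. \<zero>\<^bsub>R\<^esub>\<rparr>"

lemma lie_algebra_abelian_line:
  assumes "cring R"
  shows "lie_algebra R (abelian_line R)"
proof -
  interpret cring R by fact
  have "\<exists>y\<in>carrier R. x \<oplus>\<^bsub>R\<^esub> y = \<zero>\<^bsub>R\<^esub>" if "x \<in> carrier R" for x
    using that by (intro bexI[of _ "\<ominus>\<^bsub>R\<^esub> x"]) (auto simp: r_neg)
  then show ?thesis
    unfolding lie_algebra_def Let_def unfolding abelian_line_def by (simp add: a_ac m_assoc l_distr r_distr)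
qed

definition heisenberg :: "('r, 'b) ring_scheme \<Rightarrow> ('r, 'r \<times> 'r \<times> 'r) liealg" where
  "heisenberg R = \<lparr>lcarrier = carrier R \<times> carrier R \<times> carrier R,
    ladd = (\<lambda>(x, y, z) (x', y', z'). (x \<oplus>\<^bsub>R\<^esub> x', y \<oplus>\<^bsub>R\<^esub> y', z \<oplus>\<^bsub>R\<^esub> z')),
    lzero = (\<zero>\<^bsub>R\<^esub>, \<zero>\<^bsub>R\<^esub>, \<zero>\<^bsub>R\<^esub>),
    lsmult = (\<lambda>r (x, y, z). (r \<otimes>\<^bsub>R\<^esub> x, r \<otimes>\<^bsub>R\<^esub> y, r \<otimes>\<^bsub>R\<^esub> z)),
    lbr = (\<lambda>(x, y, z) (x', y', z'). (\<zero>\<^bsub>R\<^esub>, \<zero>\<^bsub>R\<^esub>, x \<otimes>\<^bsub>R\<^esub> y' \<ominus>\<^bsub>R\<^esub> y \<otimes>\<^bsub>R\<^esub> x'))\<rparr>"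

lemma lie_algebra_heisenberg:
  assumes "cring R"
  shows "lie_algebra R (heisenberg R)"
proof -
  interpret cring R by fact
  have inv: "\<exists>y\<in>carrier R \<times> carrier R \<times> carrier R.
      (case x of (x, y, z) \<Rightarrow> \<lambda>(x', y', z'). (x \<oplus>\<^bsub>R\<^esub> x', y \<oplus>\<^bsub>R\<^esub> y', z \<oplus>\<^bsub>R\<^esub> z')) y = (\<zero>\<^bsub>R\<^esub>, \<zero>\<^bsub>R\<^esub>, \<zero>\<^bsub>R\<^esub>)"
    if "x \<in> carrier R \<times> carrier R \<times> carrier R" for x
    using that
    by (intro bexI[of _ "(\<ominus>\<^bsub>R\<^esub> fst x, \<ominus>\<^bsub>R\<^esub> fst (snd x), \<ominus>\<^bsub>R\<^esub> snd (snd x))"]) (auto simp: r_neg)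
  show ?thesis
    unfolding lie_algebra_def Let_def unfolding heisenberg_def liealg.simps
    by (intro conjI ballI inv) (auto simp: a_ac m_ac minus_eq r_neg l_distr r_distr l_minus r_minus minus_add)
qed

lemma in_variety_abelian_line:
  assumes "cring R" "v = AllLie \<or> v = Metabelian \<or> (\<exists>m\<ge>2. v = Nilpotent m)"
  shows "in_variety (abelian_line R) v"
proof -
  have "lie_alg R (abelian_line R)"
    by (intro lie_alg.intro lie_alg_axioms.intro lie_algebra_abelian_line assms)
  then show ?thesis
    by (rule in_variety_class_two[OF _ _ assms(2)]) (simp add: abelian_line_def)
qed

lemma in_variety_heisenberg:
  assumes "cring R" "v = AllLie \<or> v = Metabelian \<or> (\<exists>m\<ge>2. v = Nilpotent m)"
  shows "in_variety (heisenberg R) v"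
proof -
  interpret cring R by fact
  have "lie_alg R (heisenberg R)"
    by (intro lie_alg.intro lie_alg_axioms.intro lie_algebra_heisenberg assms)
  then show ?thesis
    by (rule in_variety_class_two[OF _ _ assms(2)]) (auto simp: heisenberg_def minus_eq)
qed

section \<open>Formal power series over a Lie algebra\<close>

definition power_series_lie :: "('r, 'a) liealg \<Rightarrow> ('r, nat \<Rightarrow> 'a) liealg" where
  "power_series_lie L = \<lparr>lcarrier = {f. \<forall>n. f n \<in> lcarrier L},
    ladd = \<lambda>f g n. ladd L (f n) (g n), lzero = \<lambda>_. lzero L, lsmult = \<lambda>r f n. lsmult L r (f n),
    lbr = \<lambda>f g n. finsum (additive_group L) (\<lambda>i. lbr L (f i) (g (n - i))) {..n}\<rparr>"

context lie_alg
begin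

lemma convolution_self:
  fixes n :: nat
  assumes f: "\<And>n. f n \<in> V"
  shows "lsum (\<lambda>i. \<langle>f i, f (n - i)\<rangle>) {..n} = nul"
proof -
  let ?g = "\<lambda>i. \<langle>f i, f (n - i)\<rangle>"
  let ?A = "{i. 2 * i < n}" and ?B = "{i. i \<le> n \<and> n < 2 * i}" and ?C = "{i. 2 * i = n}"
  have fin: "finite ?A" "finite ?B" "finite ?C"
    by (rule finite_subset[of _ "{..n}"]; auto)+
  have B: "?B = (\<lambda>i. n - i) ` ?A"
  proof (intro equalityI subsetI)
    fix i assume "i \<in> ?B"
    then show "i \<in> (\<lambda>i. n - i) ` ?A" by (intro image_eqI[of _ _ "n - i"]) auto
  qed auto
  have "lsum ?g ?B = lsum (\<lambda>i. ?g (n - i)) ?A"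
    unfolding B using f by (intro G.finsum_reindex) (auto simp: inj_on_def)
  also have "\<dots> = lsum (\<lambda>i. \<langle>f (n - i), f i\<rangle>) ?A"
    using f by (intro G.finsum_cong') auto
  finally have "lsum ?g ?A \<boxplus> lsum ?g ?B = lsum (\<lambda>i. ?g i \<boxplus> \<langle>f (n - i), f i\<rangle>) ?A"
    using f by (simp add: G.finsum_addf)
  also have "\<dots> = nul"
    using f by (intro G.add.finprod_one_eqI) (simp add: bracket_anticommute)
  finally have AB: "lsum ?g (?A \<union> ?B) = nul"
    using f fin by (subst G.finsum_Un_disjoint) auto
  have C: "lsum ?g ?C = nul"
  proof (rule G.add.finprod_one_eqI)
    fix i assume "i \<in> ?C"
    then have "n - i = i" by simp
    then show "?g i = nul" using f by simp
  qed
  have "{..n} = ?A \<union> ?B \<union> ?C" by auto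
  also have "lsum ?g \<dots> = nul"
    using f fin AB C by (subst G.finsum_Un_disjoint) auto
  finally show ?thesis .
qed

lemma convolution_assoc:
  fixes n :: nat
  assumes "\<And>n. f n \<in> V" "\<And>n. g n \<in> V" "\<And>n. h n \<in> V"
  shows "lsum (\<lambda>k. \<langle>lsum (\<lambda>i. \<langle>f i, g (k - i)\<rangle>) {..k}, h (n - k)\<rangle>) {..n} =
    lsum (\<lambda>(i, j, k). \<langle>\<langle>f i, g j\<rangle>, h k\<rangle>) {(i, j, k). i + j + k = n}"
proof -
  have "lsum (\<lambda>k. \<langle>lsum (\<lambda>i. \<langle>f i, g (k - i)\<rangle>) {..k}, h (n - k)\<rangle>) {..n} =
      lsum (\<lambda>k. lsum (\<lambda>i. \<langle>\<langle>f i, g (k - i)\<rangle>, h (n - k)\<rangle>) {..k}) {..n}"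
    using assms by (intro G.finsum_cong' bracket_lsum_left) (auto intro!: G.finsum_closed)
  also have "\<dots> = lsum (\<lambda>(k, i). \<langle>\<langle>f i, g (k - i)\<rangle>, h (n - k)\<rangle>) (SIGMA k:{..n}. {..k})"
    using assms by (intro lsum_Sigma) auto
  also have "\<dots> = lsum (\<lambda>p. (\<lambda>(i, j, k). \<langle>\<langle>f i, g j\<rangle>, h k\<rangle>) ((\<lambda>(k, i). (i, k - i, n - k)) p))
      (SIGMA k:{..n}. {..k})"
    using assms by (intro G.finsum_cong') auto
  also have "\<dots> = lsum (\<lambda>(i, j, k). \<langle>\<langle>f i, g j\<rangle>, h k\<rangle>) ((\<lambda>(k, i). (i, k - i, n - k)) ` (SIGMA k:{..n}. {..k}))"
    using assms by (intro G.finsum_reindex[symmetric]) (auto simp: inj_on_def)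
  also have "(\<lambda>(k, i). (i, k - i, n - k)) ` (SIGMA k:{..n}. {..k}) = {(i, j, k). i + j + k = n}"
  proof (intro equalityI subsetI)
    fix p assume "p \<in> {(i, j, k). i + j + k = n}"
    then obtain i j k where "p = (i, j, k)" "i + j + k = n" by auto
    then show "p \<in> (\<lambda>(k, i). (i, k - i, n - k)) ` (SIGMA k:{..n}. {..k})"
      by (intro image_eqI[of _ _ "(i + j, i)"]) auto
  qed auto
  finally show ?thesis .
qed

lemma lsum_rotate_triples:
  fixes n :: nat
  assumes "\<And>i j k. F i j k \<in> V"
  shows "lsum (\<lambda>(i, j, k). F i j k) {(i, j, k). i + j + k = n} =
    lsum (\<lambda>(i, j, k). F j k i) {(i, j, k). i + j + k = n}"
proof -
  let ?T = "{(i, j, k). i + j + k = n}" and ?r = "\<lambda>(i, j, k). (j, k, i)"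
  have "lsum (\<lambda>(i, j, k). F i j k) (?r ` ?T) = lsum (\<lambda>p. (\<lambda>(i, j, k). F i j k) (?r p)) ?T"
    using assms by (intro G.finsum_reindex) (auto simp: inj_on_def)
  also have "\<dots> = lsum (\<lambda>(i, j, k). F j k i) ?T"
    using assms by (intro G.finsum_cong') auto
  also have "?r ` ?T = ?T"
  proof (intro equalityI subsetI)
    fix p assume "p \<in> ?T"
    then obtain i j k where "p = (i, j, k)" "i + j + k = n" by auto
    then show "p \<in> ?r ` ?T" by (intro image_eqI[of _ _ "(k, i, j)"]) auto
  qed auto
  finally show ?thesis .
qed

lemma convolution_jacobi:
  fixes n :: nat
  assumes f: "\<And>n. f n \<in> V" "\<And>n. g n \<in> V" "\<And>n. h n \<in> V"
  shows "lsum (\<lambda>k. \<langle>lsum (\<lambda>i. \<langle>f i, g (k - i)\<rangle>) {..k}, h (n - k)\<rangle>) {..n} \<boxplus>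
    lsum (\<lambda>k. \<langle>lsum (\<lambda>i. \<langle>g i, h (k - i)\<rangle>) {..k}, f (n - k)\<rangle>) {..n} \<boxplus>
    lsum (\<lambda>k. \<langle>lsum (\<lambda>i. \<langle>h i, f (k - i)\<rangle>) {..k}, g (n - k)\<rangle>) {..n} = nul"
proof -
  let ?T = "{(i, j, k). i + j + k = n}"
  have 1: "lsum (\<lambda>(i, j, k). \<langle>\<langle>g i, h j\<rangle>, f k\<rangle>) ?T = lsum (\<lambda>(i, j, k). \<langle>\<langle>g j, h k\<rangle>, f i\<rangle>) ?T"
    using lsum_rotate_triples[of "\<lambda>i j k. \<langle>\<langle>g i, h j\<rangle>, f k\<rangle>"] f by simp
  have 2: "lsum (\<lambda>(i, j, k). \<langle>\<langle>h i, f j\<rangle>, g k\<rangle>) ?T = lsum (\<lambda>(i, j, k). \<langle>\<langle>h k, f i\<rangle>, g j\<rangle>) ?T"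
    using lsum_rotate_triples[of "\<lambda>i j k. \<langle>\<langle>h i, f j\<rangle>, g k\<rangle>"]
      lsum_rotate_triples[of "\<lambda>i j k. \<langle>\<langle>h j, f k\<rangle>, g i\<rangle>"] f by simp
  define X where "X = (\<lambda>(i, j, k). \<langle>\<langle>f i, g j\<rangle>, h k\<rangle>)"
  define Y where "Y = (\<lambda>(i, j, k). \<langle>\<langle>g j, h k\<rangle>, f i\<rangle>)"
  define Z where "Z = (\<lambda>(i, j, k). \<langle>\<langle>h k, f i\<rangle>, g j\<rangle>)"
  have [simp]: "X p \<in> V" "Y p \<in> V" "Z p \<in> V" for p
    using f by (auto simp: X_def Y_def Z_def split: prod.split)
  have "lsum X ?T \<boxplus> lsum Y ?T \<boxplus> lsum Z ?T = lsum (\<lambda>p. X p \<boxplus> Y p \<boxplus> Z p) ?T"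
    by (simp add: G.finsum_addf)
  also have "\<dots> = nul"
    using f by (intro G.add.finprod_one_eqI) (auto simp: X_def Y_def Z_def jacobi)
  finally show ?thesis
    using f by (simp add: convolution_assoc 1 2 X_def Y_def Z_def)
qed

lemma lie_algebra_power_series: "lie_algebra R (power_series_lie L)"
proof -
  have inv: "\<exists>y\<in>{f. \<forall>n. f n \<in> V}. (\<lambda>n. x n \<boxplus> y n) = (\<lambda>_. nul)" if "x \<in> {f. \<forall>n. f n \<in> V}" for x
    using that by (intro bexI[of _ "\<lambda>n. (\<ominus> \<one>) \<odot> x n"]) auto
  show ?thesis
    unfolding lie_algebra_def Let_def unfolding power_series_lie_def liealg.simps
    by (intro conjI ballI inv ext,
      simp_all add: smult_add_left smult_add_right smult_assoc bracket_add_left bracket_add_right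
        bracket_smult_left bracket_smult_right smult_lsum G.finsum_addf G.finsum_closed
        convolution_self convolution_jacobi,
      simp add: add_assoc, simp add: add_commute)
qed

end

section \<open>Partially commutative Lie algebras\<close>

locale pc_lie_alg = lie_alg R L for R :: "('r, 'b) ring_scheme" (structure) and L :: "('r, 'a) liealg" +
  fixes v :: variety and A :: "'v set" and E :: "'v \<Rightarrow> 'v \<Rightarrow> bool" and \<iota> :: "'v \<Rightarrow> 'a"
  assumes dom: "domain R" and finite_A: "finite A" and A_nonempty: "A \<noteq> {}"
    and E_sym: "E a b \<Longrightarrow> E b a"
    and v: "v = AllLie \<or> v = Metabelian \<or> (\<exists>m\<ge>2. v = Nilpotent m)"
    and pc: "pc_lie_algebra R v A E L \<iota>"
begin

lemma variety_L: "in_variety L v"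
  and gen_closed [simp]: "a \<in> A \<Longrightarrow> \<iota> a \<in> V"
  and gen_bracket: "a \<in> A \<Longrightarrow> b \<in> A \<Longrightarrow> E a b \<Longrightarrow> \<langle>\<iota> a, \<iota> b\<rangle> = nul"
  and generated: "generated_by R L (\<iota> ` A)"
  using pc unfolding pc_lie_algebra_def by auto

lemmas universal = pc_lie_algebra_universal[OF dom finite_A A_nonempty pc]

lemma gens_closed: "\<iota> ` A \<subseteq> V"
  by auto

subsection \<open>Coordinates modulo the derived algebra\<close>

definition coord :: "'v \<Rightarrow> 'a \<Rightarrow> 'r" where
  "coord a = (SOME h. lie_hom R L (abelian_line R) h \<and> (\<forall>b\<in>A. h (\<iota> b) = (if b = a then \<one> else \<zero>)))"

lemma
  shows coord_hom: "lie_hom R L (abelian_line R) (coord a)"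
    and coord_gen: "b \<in> A \<Longrightarrow> coord a (\<iota> b) = (if b = a then \<one> else \<zero>)"
proof -
  obtain h where "lie_hom R L (abelian_line R) h" "\<And>b. b \<in> A \<Longrightarrow> h (\<iota> b) = (if b = a then \<one> else \<zero>)"
    by (rule universal[where f = "\<lambda>b. if b = a then \<one> else \<zero>",
          OF lie_algebra_abelian_line[OF R.is_cring] in_variety_abelian_line[OF R.is_cring v]])
      (auto simp: abelian_line_def)
  then have "\<exists>h. lie_hom R L (abelian_line R) h \<and> (\<forall>b\<in>A. h (\<iota> b) = (if b = a then \<one> else \<zero>))"
    by blast
  then have *: "lie_hom R L (abelian_line R) (coord a) \<and> (\<forall>b\<in>A. coord a (\<iota> b) = (if b = a then \<one> else \<zero>))"
    unfolding coord_def by (rule someI_ex)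
  then show "lie_hom R L (abelian_line R) (coord a)" by blast
  show "b \<in> A \<Longrightarrow> coord a (\<iota> b) = (if b = a then \<one> else \<zero>)" using * by blast
qed

lemma coord_closed [simp]: "x \<in> V \<Longrightarrow> coord a x \<in> carrier R"
  and coord_add: "x \<in> V \<Longrightarrow> y \<in> V \<Longrightarrow> coord a (x \<boxplus> y) = coord a x \<oplus> coord a y"
  and coord_smult: "r \<in> carrier R \<Longrightarrow> x \<in> V \<Longrightarrow> coord a (r \<odot> x) = r \<otimes> coord a x"
  and coord_bracket [simp]: "x \<in> V \<Longrightarrow> y \<in> V \<Longrightarrow> coord a \<langle>x, y\<rangle> = \<zero>"
  using coord_hom[of a] unfolding lie_hom_def by (auto simp: abelian_line_def)

lemma coord_zero [simp]: "coord a nul = \<zero>"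
  using coord_smult[of \<zero> nul a] by simp

lemma coord_eqI:
  assumes "lie_hom R L (abelian_line R) h" "\<And>b. b \<in> A \<Longrightarrow> h (\<iota> b) = (if b = a then \<one> else \<zero>)" "x \<in> V"
  shows "h x = coord a x"
  by (rule lie_hom_eq_on_generators[OF lie_algebra_abelian_line[OF R.is_cring] assms(1) coord_hom
        generated gens_closed _ assms(3)])
    (auto simp: assms(2) coord_gen)

lemma coord_proportional:
  assumes ab: "a \<in> A" "b \<in> A" "a \<noteq> b" "\<not> E a b" and xy: "x \<in> V" "y \<in> V" "\<langle>x, y\<rangle> = nul"
  shows "coord a x \<otimes> coord b y = coord b x \<otimes> coord a y"
proof -
  define f where "f c = (if c = a then \<one> else \<zero>, if c = b then \<one> else \<zero>, \<zero>)" for c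
  have "\<not> E b a" using ab E_sym by blast
  obtain h where h: "lie_hom R L (heisenberg R) h" "\<And>c. c \<in> A \<Longrightarrow> h (\<iota> c) = f c"
  proof (rule universal[where f = f,
        OF lie_algebra_heisenberg[OF R.is_cring] in_variety_heisenberg[OF R.is_cring v]])
    show "f c \<in> lcarrier (heisenberg R)" for c by (auto simp: f_def heisenberg_def)
    show "lbr (heisenberg R) (f c) (f d) = lzero (heisenberg R)" if "E c d" for c d
      using that ab \<open>\<not> E b a\<close> by (auto simp: f_def heisenberg_def R.minus_eq)
  qed blast
  have hom: "lie_hom R L (abelian_line R) (\<lambda>x. fst (h x))" "lie_hom R L (abelian_line R) (\<lambda>x. fst (snd (h x)))"
    using h(1) unfolding lie_hom_def
    by (auto simp: heisenberg_def abelian_line_def split_beta mem_Times_iff)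
  have fst: "fst (h x) = coord a x" and snd: "fst (snd (h x)) = coord b x" if "x \<in> V" for x
    using that by (auto intro!: coord_eqI hom simp: h(2) f_def)
  have "h \<langle>x, y\<rangle> = lbr (heisenberg R) (h x) (h y)"
    using h(1) xy unfolding lie_hom_def by blast
  then have "lbr (heisenberg R) (h x) (h y) = lzero (heisenberg R)"
    using lie_hom_zero[OF lie_algebra_heisenberg[OF R.is_cring] h(1)] xy by simp
  then have "coord a x \<otimes> coord b y \<ominus> coord b x \<otimes> coord a y = \<zero>"
    using fst snd xy by (simp add: heisenberg_def split_beta)
  then show ?thesis using xy by (simp add: R.minus_eq R.add.inv_solve_right')
qed

lemma in_derived_if_coords_vanish:
  assumes x: "x \<in> V" "\<And>a. a \<in> A \<Longrightarrow> coord a x = \<zero>"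
  shows "x \<in> span (brackets L V V)"
proof -
  let ?D = "brackets L V V"
  have D: "?D \<subseteq> V" by (rule brackets_closed) auto
  have "span (?D \<union> \<iota> ` A) \<subseteq> V" using D by (intro span_closed) auto
  moreover have "\<langle>x, y\<rangle> \<in> span (?D \<union> \<iota> ` A)" if "x \<in> V" "y \<in> V" for x y
    using that by (intro modspan.base) (auto simp: brackets_def)
  ultimately have "lie_subalgebra R L (span (?D \<union> \<iota> ` A))"
    unfolding lie_subalgebra_def by (simp add: modspan.intros subset_iff)
  then have xA: "x \<in> span (?D \<union> \<iota> ` A)"
    using generated_by_induct[OF generated] x(1) by (blast intro: modspan.base)
  have "y \<in> span ?D" if "finite B" "B \<subseteq> A" "y \<in> span (?D \<union> \<iota> ` B)" "\<And>b. b \<in> B \<Longrightarrow> coord b y = \<zero>" for B y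
    using that
  proof (induction B arbitrary: y rule: finite_induct)
    case (insert b B)
    have sub: "?D \<union> \<iota> ` B \<subseteq> V" using D insert.prems by auto
    have b: "b \<in> A" using insert.prems by auto
    obtain r z where rz: "r \<in> carrier R" "z \<in> span (?D \<union> \<iota> ` B)" "y = r \<odot> \<iota> b \<boxplus> z"
      using span_insert_decompose[of "\<iota> b" "?D \<union> \<iota> ` B" y] insert.prems sub b by auto
    have "span (?D \<union> \<iota> ` B) \<subseteq> {z \<in> V. coord b z = \<zero>}"
      using insert.prems insert.hyps D
      by (intro span_minimal) (auto simp: coord_gen coord_add coord_smult brackets_def)
    then have z: "z \<in> V" "coord b z = \<zero>" using rz by auto
    have "r = coord b y" using rz z b by (simp add: coord_add coord_smult coord_gen)
    then have "r = \<zero>" using insert.prems by simp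
    then have "y = z" using rz z b by simp
    then show ?case using insert.IH[of z] insert.prems rz by auto
  qed simp
  from this[OF finite_A subset_refl xA] x(2) show ?thesis by simp
qed

subsection \<open>Perfect subalgebras are trivial\<close>

definition grading :: "'a \<Rightarrow> nat \<Rightarrow> 'a" where
  "grading = (SOME h. lie_hom R L (power_series_lie L) h \<and> (\<forall>a\<in>A. h (\<iota> a) = (\<lambda>n. if n = 1 then \<iota> a else nul)))"

text \<open>If the defining relations are homogeneous and no further identities are imposed, then
  \<open>a \<mapsto> t a\<close> extends to a homomorphism into the power series over \<^term>\<open>L\<close>; its coefficients are the
  homogeneous components.\<close>

lemma
  assumes "v = AllLie"
  shows grading_hom: "lie_hom R L (power_series_lie L) grading"
    and grading_gen: "a \<in> A \<Longrightarrow> grading (\<iota> a) = (\<lambda>n. if n = 1 then \<iota> a else nul)"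
proof -
  let ?f = "\<lambda>a (n::nat). if n = 1 then \<iota> a else nul"
  obtain h where "lie_hom R L (power_series_lie L) h" "\<And>a. a \<in> A \<Longrightarrow> h (\<iota> a) = ?f a"
  proof (rule universal[where f = ?f, OF lie_algebra_power_series])
    show "in_variety (power_series_lie L) v" using assms by simp
  next
    show "?f a \<in> lcarrier (power_series_lie L)" if "a \<in> A" for a
      using that by (simp add: power_series_lie_def)
    show "lbr (power_series_lie L) (?f a) (?f b) = lzero (power_series_lie L)"
      if "a \<in> A" "b \<in> A" "E a b" for a b
      unfolding power_series_lie_def liealg.simps
    proof (intro ext G.add.finprod_one_eqI)
      fix n i :: nat
      show "\<langle>?f a i, ?f b (n - i)\<rangle> = nul" using that by (simp add: gen_bracket)
    qed
  qed blast
  then have "\<exists>h. lie_hom R L (power_series_lie L) h \<and> (\<forall>a\<in>A. h (\<iota> a) = ?f a)" by blast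
  then have *: "lie_hom R L (power_series_lie L) grading \<and> (\<forall>a\<in>A. grading (\<iota> a) = ?f a)"
    unfolding grading_def by (rule someI_ex)
  then show "lie_hom R L (power_series_lie L) grading" by blast
  show "a \<in> A \<Longrightarrow> grading (\<iota> a) = ?f a" using * by blast
qed

context
  assumes free: "v = AllLie"
begin

lemma grading_closed [simp]: "x \<in> V \<Longrightarrow> grading x n \<in> V"
  and grading_add: "x \<in> V \<Longrightarrow> y \<in> V \<Longrightarrow> grading (x \<boxplus> y) n = grading x n \<boxplus> grading y n"
  and grading_smult: "r \<in> carrier R \<Longrightarrow> x \<in> V \<Longrightarrow> grading (r \<odot> x) n = r \<odot> grading x n"
  and grading_bracket: "x \<in> V \<Longrightarrow> y \<in> V \<Longrightarrow>
    grading \<langle>x, y\<rangle> n = lsum (\<lambda>i. \<langle>grading x i, grading y (n - i)\<rangle>) {..n}"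
  using grading_hom[OF free] unfolding lie_hom_def by (auto simp: power_series_lie_def)

lemma grading_zero [simp]: "grading nul n = nul"
  using grading_smult[of \<zero> nul n] by simp

lemma grading_degree_zero:
  assumes "x \<in> V"
  shows "grading x 0 = nul"
proof -
  have "lie_subalgebra R L {x \<in> V. grading x 0 = nul}"
    unfolding lie_subalgebra_def by (auto simp: grading_add grading_smult grading_bracket)
  moreover have "\<iota> ` A \<subseteq> {x \<in> V. grading x 0 = nul}"
    by (auto simp: grading_gen[OF free])
  ultimately show ?thesis using generated_by_induct[OF generated] assms by blast
qed

lemma grading_lie_prod:
  "lie_prod L k x \<Longrightarrow> n < k \<Longrightarrow> grading x n = nul"
proof (induction arbitrary: n rule: lie_prod.induct)
  case (single x)
  then show ?case by (simp add: grading_degree_zero)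
next
  case (bracket i u j w)
  have uw: "u \<in> V" "w \<in> V" using bracket lie_prod_carrier[OF lie_alg_axioms] by auto
  have "\<langle>grading u l, grading w (n - l)\<rangle> = nul" for l
  proof (cases "l < i")
    case True
    then show ?thesis using bracket.IH(1) uw by simp
  next
    case False
    then have "n - l < j" using bracket.prems lie_prod_pos[OF bracket.hyps(2)] by linarith
    then show ?thesis using bracket.IH(2) uw by simp
  qed
  then show ?case using uw by (simp add: grading_bracket)
qed

lemma carrier_span_homogeneous:
  "V \<subseteq> span {x \<in> V. \<exists>k. \<forall>n. grading x n = (if n = k then x else nul)}" (is "_ \<subseteq> span ?H")
proof (rule generated_by_induct[OF generated])
  have HV: "?H \<subseteq> V" by auto
  have "\<langle>x, y\<rangle> \<in> ?H" if "x \<in> ?H" "y \<in> ?H" for x y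
  proof -
    obtain k l where xy: "x \<in> V" "y \<in> V" and k: "\<And>n. grading x n = (if n = k then x else nul)"
      and l: "\<And>n. grading y n = (if n = l then y else nul)"
      using \<open>x \<in> ?H\<close> \<open>y \<in> ?H\<close> by blast
    have "grading \<langle>x, y\<rangle> n = (if n = k + l then \<langle>x, y\<rangle> else nul)" for n
    proof (cases "n = k + l")
      case True
      have "lsum (\<lambda>i. \<langle>grading x i, grading y (n - i)\<rangle>) {..n} = \<langle>grading x k, grading y (n - k)\<rangle>"
        using xy True by (intro lsum_eq_single) (auto simp: k)
      then show ?thesis using xy True by (simp add: grading_bracket k l)
    next
      case False
      have "lsum (\<lambda>i. \<langle>grading x i, grading y (n - i)\<rangle>) {..n} = nul"
        using xy False by (intro G.add.finprod_one_eqI) (auto simp: k l)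
      then show ?thesis using xy False by (simp add: grading_bracket)
    qed
    moreover have "\<langle>x, y\<rangle> \<in> V" using xy by simp
    ultimately show ?thesis by blast
  qed
  then have "brackets L ?H ?H \<subseteq> ?H" unfolding brackets_def by blast
  then have "span (brackets L ?H ?H) \<subseteq> span ?H" by (rule span_mono)
  then have bracket: "\<langle>x, y\<rangle> \<in> span ?H" if "x \<in> span ?H" "y \<in> span ?H" for x y
    using bracket_in_span_brackets[OF HV HV that] by (rule subsetD)
  show "lie_subalgebra R L (span ?H)"
    unfolding lie_subalgebra_def
    by (intro conjI ballI modspan.zero modspan.add modspan.smult bracket span_closed HV)
  show "\<iota> ` A \<subseteq> span ?H"
  proof (intro subsetI modspan.base)
    fix x assume "x \<in> \<iota> ` A"
    then obtain a where "a \<in> A" "x = \<iota> a" by blast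
    then have "\<forall>n. grading x n = (if n = 1 then x else nul)" "x \<in> V"
      by (simp_all add: grading_gen[OF free])
    then show "x \<in> ?H" by blast
  qed
qed

lemma grading_injective:
  assumes "x \<in> V" "\<And>n. grading x n = nul"
  shows "x = nul"
proof -
  let ?T = "{x \<in> V. \<exists>N. \<forall>M\<ge>N. lsum (grading x) {..<M} = x}"
  have "span {x \<in> V. \<exists>k. \<forall>n. grading x n = (if n = k then x else nul)} \<subseteq> ?T"
  proof (rule span_minimal)
    show "{x \<in> V. \<exists>k. \<forall>n. grading x n = (if n = k then x else nul)} \<subseteq> ?T"
    proof (clarify, rule exI, intro allI impI)
      fix x k M assume x: "x \<in> V" "\<forall>n. grading x n = (if n = k then x else nul)" and M: "Suc k \<le> M"
      have "lsum (grading x) {..<M} = grading x k"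
        using x M by (intro lsum_eq_single) auto
      then show "lsum (grading x) {..<M} = x" using x by simp
    qed
    show "nul \<in> ?T" by (auto intro!: G.add.finprod_one_eqI)
  next
    fix x y assume "x \<in> ?T" "y \<in> ?T"
    then obtain N N' where xy: "x \<in> V" "y \<in> V" and N: "\<And>M. M \<ge> N \<Longrightarrow> lsum (grading x) {..<M} = x"
      "\<And>M. M \<ge> N' \<Longrightarrow> lsum (grading y) {..<M} = y" by blast
    have "grading (x \<boxplus> y) = (\<lambda>n. grading x n \<boxplus> grading y n)"
      using xy by (intro ext grading_add)
    then have "lsum (grading (x \<boxplus> y)) {..<M} = x \<boxplus> y" if "M \<ge> max N N'" for M
      using that xy N by (simp add: G.finsum_addf)
    moreover have "x \<boxplus> y \<in> V" using xy by simp
    ultimately show "x \<boxplus> y \<in> ?T" by blast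
  next
    fix r x assume r: "r \<in> carrier R" and "x \<in> ?T"
    then obtain N where x: "x \<in> V" and N: "\<And>M. M \<ge> N \<Longrightarrow> lsum (grading x) {..<M} = x" by blast
    have "grading (r \<odot> x) = (\<lambda>n. r \<odot> grading x n)"
      using x r by (intro ext grading_smult)
    then have "lsum (grading (r \<odot> x)) {..<M} = r \<odot> x" if "M \<ge> N" for M
      using that x r N smult_lsum[of r "grading x" "{..<M}"] by simp
    moreover have "r \<odot> x \<in> V" using x r by simp
    ultimately show "r \<odot> x \<in> ?T" by blast
  qed
  then obtain N where "lsum (grading x) {..<N} = x"
    using carrier_span_homogeneous assms(1) by blast
  moreover have "lsum (grading x) {..<N} = nul"
    using assms(2) by (intro G.add.finprod_one_eqI)
  ultimately show ?thesis by simp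
qed

end

lemma perfect_subalgebra_trivial:
  assumes S: "lie_subalgebra R L S" "S \<subseteq> span (brackets L S S)" and x: "x \<in> S"
  shows "x = nul"
proof -
  have SV: "S \<subseteq> V" using S(1) by (simp add: lie_subalgebra_def)
  have trivial: "span X \<subseteq> {nul}" if "X \<subseteq> {nul}" for X
    using that by (intro span_minimal) auto
  note P = perfect_in_span_lie_prod[OF S]
  from v show ?thesis
  proof (elim disjE exE conjE)
    assume free: "v = AllLie"
    show ?thesis
    proof (rule grading_injective[OF free])
      fix n
      have "span {y. lie_prod L (Suc n) y} \<subseteq> {y \<in> V. grading y n = nul}"
        using lie_prod_carrier[OF lie_alg_axioms]
        by (intro span_minimal)
          (auto simp: grading_add[OF free] grading_smult[OF free] grading_zero[OF free] grading_lie_prod[OF free])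
      then show "grading x n = nul" using P x by blast
    qed (use SV x in auto)
  next
    assume "v = Metabelian"
    then have metabelian: "\<langle>\<langle>a, b\<rangle>, \<langle>c, d\<rangle>\<rangle> = nul" if "a \<in> V" "b \<in> V" "c \<in> V" "d \<in> V" for a b c d
      using variety_L that by simp
    have D: "brackets L S S \<subseteq> V" using SV by (intro brackets_closed)
    have "brackets L (brackets L S S) (brackets L S S) \<subseteq> {nul}"
    proof
      fix z assume "z \<in> brackets L (brackets L S S) (brackets L S S)"
      then obtain a b c d where "a \<in> S" "b \<in> S" "c \<in> S" "d \<in> S" "z = \<langle>\<langle>a, b\<rangle>, \<langle>c, d\<rangle>\<rangle>"
        unfolding brackets_def by blast
      then show "z \<in> {nul}" using metabelian SV by (simp add: subset_iff)
    qed
    from trivial[OF this] have DD: "\<langle>y, z\<rangle> = nul" if "y \<in> S" "z \<in> S" for y z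
      using bracket_in_span_brackets[OF D D, of y z] S(2) that by (simp add: subset_iff)
    then have "brackets L S S \<subseteq> {nul}" by (auto simp: brackets_def)
    from trivial[OF this] show ?thesis using S(2) x by blast
  next
    fix m :: nat assume "v = Nilpotent m"
    then have "{x. lie_prod L (Suc m) x} \<subseteq> {nul}" using variety_L by auto
    from trivial[OF this] show ?thesis using P x by blast
  qed
qed

subsection \<open>Direct sum decompositions\<close>

lemma summand_trivial_if_coords_vanish:
  assumes dec: "direct_sum_decomp R L L1 L2"
    and vanish: "\<And>a x. a \<in> A \<Longrightarrow> x \<in> L1 \<Longrightarrow> coord a x = \<zero>"
  shows "L1 = {nul}"
proof -
  have sub: "lie_subalgebra R L L1" "lie_subalgebra R L L2"
    and sum: "\<And>x. x \<in> V \<Longrightarrow> \<exists>y\<in>L1. \<exists>z\<in>L2. x = y \<boxplus> z"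
    and int: "L1 \<inter> L2 = {nul}" and comm: "\<And>y z. y \<in> L1 \<Longrightarrow> z \<in> L2 \<Longrightarrow> \<langle>y, z\<rangle> = nul"
    and LV: "L1 \<subseteq> V" "L2 \<subseteq> V"
    by (rule direct_sum_decompD[OF dec] | assumption)+
  let ?D1 = "span (brackets L L1 L1)" and ?D2 = "span (brackets L L2 L2)"
  have D1: "?D1 \<subseteq> L1" and D2: "?D2 \<subseteq> L2"
    by (rule span_subset_subalgebra; use sub in \<open>auto simp: brackets_def lie_subalgebra_def\<close>)+
  have "span (brackets L V V) \<subseteq> {x \<in> V. \<exists>y\<in>?D1. \<exists>z\<in>?D2. x = y \<boxplus> z}" (is "_ \<subseteq> ?S")
  proof (rule span_minimal)
    show "brackets L V V \<subseteq> ?S"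
    proof
      fix x assume "x \<in> brackets L V V"
      then obtain p q where pq: "p \<in> V" "q \<in> V" "x = \<langle>p, q\<rangle>" by (auto simp: brackets_def)
      obtain p1 p2 q1 q2 where *: "p1 \<in> L1" "p2 \<in> L2" "q1 \<in> L1" "q2 \<in> L2"
        "p = p1 \<boxplus> p2" "q = q1 \<boxplus> q2" using sum[OF pq(1)] sum[OF pq(2)] by blast
      then have V: "p1 \<in> V" "p2 \<in> V" "q1 \<in> V" "q2 \<in> V" using LV by auto
      have "\<langle>p1, q2\<rangle> = nul" "\<langle>p2, q1\<rangle> = nul"
        using comm[OF *(1,4)] bracket_eq_zero_commute[OF _ _ comm[OF *(3,2)]] V by simp_all
      then have "x = \<langle>p1, q1\<rangle> \<boxplus> \<langle>p2, q2\<rangle>"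
        using * V pq by (simp add: bracket_add_left bracket_add_right)
      moreover have "\<langle>p1, q1\<rangle> \<in> ?D1" "\<langle>p2, q2\<rangle> \<in> ?D2"
        by (rule modspan.base; use * in \<open>auto simp: brackets_def\<close>)+
      moreover have "x \<in> V" using pq by simp
      ultimately show "x \<in> ?S" by blast
    qed
    have "nul = nul \<boxplus> nul" "nul \<in> ?D1" "nul \<in> ?D2" by (simp_all add: modspan.zero)
    then show "nul \<in> ?S" using zero_closed by blast
  next
    fix x y assume xy: "x \<in> ?S" "y \<in> ?S"
    then obtain x1 x2 y1 y2 where *: "x1 \<in> ?D1" "x2 \<in> ?D2" "y1 \<in> ?D1" "y2 \<in> ?D2"
      "x = x1 \<boxplus> x2" "y = y1 \<boxplus> y2" by blast
    then have "x1 \<in> V" "x2 \<in> V" "y1 \<in> V" "y2 \<in> V" using LV D1 D2 by auto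
    then have "x \<boxplus> y = (x1 \<boxplus> y1) \<boxplus> (x2 \<boxplus> y2)" using * by (simp add: add_add_swap)
    moreover have "x1 \<boxplus> y1 \<in> ?D1" "x2 \<boxplus> y2 \<in> ?D2" using * by (simp_all add: modspan.add)
    moreover have "x \<boxplus> y \<in> V" using xy by simp
    ultimately show "x \<boxplus> y \<in> ?S" by blast
  next
    fix r x assume rx: "r \<in> carrier R" "x \<in> ?S"
    then obtain x1 x2 where *: "x1 \<in> ?D1" "x2 \<in> ?D2" "x = x1 \<boxplus> x2" by blast
    then have "x1 \<in> V" "x2 \<in> V" using LV D1 D2 by auto
    then have "r \<odot> x = r \<odot> x1 \<boxplus> r \<odot> x2" using * rx by (simp add: smult_add_right)
    moreover have "r \<odot> x1 \<in> ?D1" "r \<odot> x2 \<in> ?D2" using * rx by (simp_all add: modspan.smult)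
    moreover have "r \<odot> x \<in> V" using rx by simp
    ultimately show "r \<odot> x \<in> ?S" by blast
  qed
  then have split: "\<exists>y\<in>?D1. \<exists>z\<in>?D2. x = y \<boxplus> z" if "x \<in> L1" for x
    using in_derived_if_coords_vanish[of x] that vanish[OF _ that] LV by (simp add: subset_iff)
  have "L1 \<subseteq> ?D1"
  proof
    fix x assume x: "x \<in> L1"
    then obtain y z where yz: "y \<in> ?D1" "z \<in> ?D2" "x = y \<boxplus> z" using split by blast
    then have yz': "y \<in> L1" "z \<in> L2" "y \<in> V" "z \<in> V" using D1 D2 LV by auto
    have "(\<ominus> \<one>) \<odot> y \<boxplus> x = z"
    proof -
      have "(\<ominus> \<one>) \<odot> y \<boxplus> (y \<boxplus> z) = (y \<boxplus> (\<ominus> \<one>) \<odot> y) \<boxplus> z"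
        using yz' by (simp add: G.a_ac del: add_minus_one)
      then show ?thesis using yz yz' by simp
    qed
    moreover have "(\<ominus> \<one>) \<odot> y \<boxplus> x \<in> L1"
      using sub(1) x yz' by (simp add: lie_subalgebra_def)
    ultimately have "z = nul" using int yz' by auto
    then show "x \<in> ?D1" using yz yz' by simp
  qed
  then have "x = nul" if "x \<in> L1" for x
    using perfect_subalgebra_trivial[OF sub(1)] that by blast
  then show ?thesis using int by auto
qed

lemma coords_vanish_on_summand:
  assumes dec: "direct_sum_decomp R L L1 L2"
    and ab: "a \<in> A" "b \<in> A" "complement_graph E a b"
  shows "(\<forall>x\<in>L1. coord a x = \<zero> \<and> coord b x = \<zero>) \<or> (\<forall>x\<in>L2. coord a x = \<zero> \<and> coord b x = \<zero>)"
proof -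
  interpret dom: domain R by (rule dom)
  have LV: "L1 \<subseteq> V" "L2 \<subseteq> V"
    and sum: "\<And>x. x \<in> V \<Longrightarrow> \<exists>y\<in>L1. \<exists>z\<in>L2. x = y \<boxplus> z"
    and comm: "\<And>y z. y \<in> L1 \<Longrightarrow> z \<in> L2 \<Longrightarrow> \<langle>y, z\<rangle> = nul"
    by (rule direct_sum_decompD[OF dec] | assumption)+
  have nonadj: "a \<noteq> b" "\<not> E a b" using ab by (auto simp: complement_graph_def)
  have proportional: "coord a x \<otimes> coord b y = coord b x \<otimes> coord a y" if "x \<in> L1" "y \<in> L2" for x y
    using coord_proportional[OF ab(1,2) nonadj] that LV comm by blast
  obtain u w where uw: "u \<in> L1" "w \<in> L2" "\<iota> a = u \<boxplus> w" using sum[of "\<iota> a"] ab by auto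
  obtain u' w' where uw': "u' \<in> L1" "w' \<in> L2" "\<iota> b = u' \<boxplus> w'" using sum[of "\<iota> b"] ab by auto
  have V: "u \<in> V" "w \<in> V" "u' \<in> V" "w' \<in> V" using uw uw' LV by auto
  have a1: "coord a u \<oplus> coord a w = \<one>" and b0: "coord b u \<oplus> coord b w = \<zero>"
    using coord_gen[of a a] coord_gen[of a b] ab nonadj uw V by (auto simp: coord_add)
  have a0: "coord a u' \<oplus> coord a w' = \<zero>" and b1: "coord b u' \<oplus> coord b w' = \<one>"
    using coord_gen[of b a] coord_gen[of b b] ab nonadj uw' V by (auto simp: coord_add)
  have "coord b u = coord b u \<otimes> (coord a u \<oplus> coord a w)" using a1 V by simp
  also have "\<dots> = coord a u \<otimes> (coord b u \<oplus> coord b w)"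
    using proportional[OF uw(1,2)] V by (simp add: R.r_distr R.m_comm)
  finally have bu: "coord b u = \<zero>" using b0 V by simp
  then have bw: "coord b w = \<zero>" using b0 V by simp
  have "coord a u' = coord a u' \<otimes> (coord b u' \<oplus> coord b w')" using b1 V by simp
  also have "\<dots> = coord b u' \<otimes> (coord a u' \<oplus> coord a w')"
    using proportional[OF uw'(1,2)] V by (simp add: R.r_distr R.m_comm)
  finally have au': "coord a u' = \<zero>" using a0 V by simp
  then have aw': "coord a w' = \<zero>" using a0 V by simp
  have 1: "coord a u \<otimes> coord b w' = \<zero>" using proportional[OF uw(1) uw'(2)] bu V by simp
  have 2: "coord b u' \<otimes> coord a w = \<zero>" using proportional[OF uw'(1) uw(2)] au' V by simp
  from 1 V have "coord a u = \<zero> \<or> coord b w' = \<zero>" by (simp add: dom.integral_iff)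
  then show ?thesis
  proof
    assume "coord a u = \<zero>"
    then have aw: "coord a w = \<one>" using a1 V by simp
    then have "coord b u' = \<zero>" using 2 V by simp
    then have bw': "coord b w' = \<one>" using b1 V by simp
    have "coord a x = \<zero> \<and> coord b x = \<zero>" if "x \<in> L1" for x
    proof -
      have "x \<in> V" using that LV by blast
      then show ?thesis
        using proportional[OF that uw(2), symmetric] proportional[OF that uw'(2)] aw bw aw' bw' by simp
    qed
    then show ?thesis by blast
  next
    assume "coord b w' = \<zero>"
    then have bu': "coord b u' = \<one>" using b1 V by simp
    then have "coord a w = \<zero>" using 2 V by simp
    then have au: "coord a u = \<one>" using a1 V by simp
    have "coord a x = \<zero> \<and> coord b x = \<zero>" if "x \<in> L2" for x
      using proportional[OF uw(1) that] proportional[OF uw'(1) that] au bu au' bu' that LV by (simp add: subset_iff)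
    then show ?thesis by blast
  qed
qed

lemma coords_not_vanish_on_both:
  assumes dec: "direct_sum_decomp R L L1 L2" and a: "a \<in> A"
    and "\<forall>x\<in>L1. coord a x = \<zero>" "\<forall>x\<in>L2. coord a x = \<zero>"
  shows False
proof -
  interpret dom: domain R by (rule dom)
  obtain u w where "u \<in> L1" "w \<in> L2" "\<iota> a = u \<boxplus> w" "u \<in> V" "w \<in> V"
    using direct_sum_decompD(3,4)[OF dec] direct_sum_decompD(6)[OF dec gen_closed[OF a]] by blast
  then have "coord a (\<iota> a) = \<zero>" using assms by (simp add: coord_add)
  then show False using coord_gen[OF a, of a] by simp
qed

lemma connected_vanish_on_summand:
  assumes dec: "direct_sum_decomp R L L1 L2" and conn: "graph_connected A (complement_graph E)"
    and a: "a \<in> A" "\<forall>x\<in>L1. coord a x = \<zero>" and b: "b \<in> A"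
  shows "\<forall>x\<in>L1. coord b x = \<zero>"
proof -
  have "(a, b) \<in> {(x, y). x \<in> A \<and> y \<in> A \<and> complement_graph E x y}\<^sup>*"
    using conn a b by (auto simp: graph_connected_def)
  then show ?thesis
  proof induction
    case (step y z)
    then have yz: "y \<in> A" "z \<in> A" "complement_graph E y z" by auto
    show ?case
      using coords_vanish_on_summand[OF dec yz] coords_not_vanish_on_both[OF dec yz(1) step.IH] by blast
  qed (rule a)
qed

lemma connected_imp_indecomposable:
  assumes dec: "direct_sum_decomp R L L1 L2" and conn: "graph_connected A (complement_graph E)"
    and card: "card A \<ge> 2"
  shows "L1 = {nul} \<or> L2 = {nul}"
proof -
  obtain a b where ab: "a \<in> A" "b \<in> A" "a \<noteq> b"
    using card by (metis card_2_iff' obtain_subset_with_card_n subsetD)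
  have "(a, b) \<in> {(x, y). x \<in> A \<and> y \<in> A \<and> complement_graph E x y}\<^sup>*"
    using conn ab by (auto simp: graph_connected_def)
  then obtain c where c: "c \<in> A" "complement_graph E a c"
    using ab(3) by (auto elim: converse_rtranclE)
  note dec' = direct_sum_decomp_commute[OF dec]
  from coords_vanish_on_summand[OF dec ab(1) c] show ?thesis
  proof
    assume "\<forall>x\<in>L1. coord a x = \<zero> \<and> coord c x = \<zero>"
    then have "\<And>b x. b \<in> A \<Longrightarrow> x \<in> L1 \<Longrightarrow> coord b x = \<zero>"
      using connected_vanish_on_summand[OF dec conn ab(1)] by blast
    then show ?thesis using summand_trivial_if_coords_vanish[OF dec] by blast
  next
    assume "\<forall>x\<in>L2. coord a x = \<zero> \<and> coord c x = \<zero>"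
    then have "\<And>b x. b \<in> A \<Longrightarrow> x \<in> L2 \<Longrightarrow> coord b x = \<zero>"
      using connected_vanish_on_summand[OF dec' conn ab(1)] by blast
    then show ?thesis using summand_trivial_if_coords_vanish[OF dec'] by blast
  qed
qed

lemma disconnected_imp_decomposable:
  assumes "\<not> graph_connected A (complement_graph E)"
  shows "\<exists>L1 L2. direct_sum_decomp R L L1 L2 \<and> L1 \<noteq> {nul} \<and> L2 \<noteq> {nul}"
proof -
  interpret dom: domain R by (rule dom)
  define r where "r = {(x, y). x \<in> A \<and> y \<in> A \<and> complement_graph E x y}"
  obtain a b where ab: "a \<in> A" "b \<in> A" "(a, b) \<notin> r\<^sup>*"
    using assms A_nonempty unfolding graph_connected_def r_def by blast
  define B where "B = {c \<in> A. (a, c) \<in> r\<^sup>*}"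
  define C where "C = A - B"
  have BC: "a \<in> B" "b \<in> C" "B \<subseteq> A" "C \<subseteq> A" "A = B \<union> C" "B \<inter> C = {}"
    unfolding C_def B_def using ab by blast+
  have adj: "E x y" if "x \<in> B" "y \<in> C" for x y
  proof (rule ccontr)
    assume "\<not> E x y"
    moreover have xy: "x \<in> A" "y \<in> A" "x \<noteq> y" using that BC by blast+
    ultimately have "(x, y) \<in> r" by (simp add: r_def complement_graph_def)
    moreover have "(a, x) \<in> r\<^sup>*" using that by (simp add: B_def)
    ultimately have "y \<in> B" using xy by (simp add: B_def rtrancl.rtrancl_into_rtrancl)
    then show False using that BC by blast
  qed
  define L1 where "L1 = subalgebra_generated R L (\<iota> ` B)"
  define L2 where "L2 = subalgebra_generated R L (\<iota> ` C)"
  have gV: "\<iota> ` B \<subseteq> V" "\<iota> ` C \<subseteq> V" using BC by auto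
  have sub: "lie_subalgebra R L L1" "lie_subalgebra R L L2"
    unfolding L1_def L2_def by (rule lie_subalgebra_generated, rule gV)+
  have LV: "L1 \<subseteq> V" "L2 \<subseteq> V" using sub unfolding lie_subalgebra_def by blast+
  have gL: "\<iota> ` B \<subseteq> L1" "\<iota> ` C \<subseteq> L2"
    unfolding L1_def L2_def by (rule subset_subalgebra_generated)+
  have "L1 \<subseteq> {y \<in> V. \<forall>x\<in>\<iota> ` C. \<langle>y, x\<rangle> = nul}"
    unfolding L1_def
  proof (intro subalgebra_generated_minimal centralizer_subalgebra gV)
    show "\<iota> ` B \<subseteq> {y \<in> V. \<forall>x\<in>\<iota> ` C. \<langle>y, x\<rangle> = nul}"
      using BC(3,4) adj gV(1) gen_bracket by blast
  qed
  then have L1_comm: "\<langle>x, y\<rangle> = nul" if "x \<in> \<iota> ` C" "y \<in> L1" for x y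
    using bracket_eq_zero_commute[of y x] that gV by blast
  have "L2 \<subseteq> {y \<in> V. \<forall>x\<in>L1. \<langle>y, x\<rangle> = nul}"
    unfolding L2_def
  proof (intro subalgebra_generated_minimal centralizer_subalgebra LV)
    show "\<iota> ` C \<subseteq> {y \<in> V. \<forall>x\<in>L1. \<langle>y, x\<rangle> = nul}" using L1_comm gV by blast
  qed
  then have comm': "\<langle>z, y\<rangle> = nul" if "y \<in> L1" "z \<in> L2" for y z
    using that by blast
  then have comm: "\<langle>y, z\<rangle> = nul" if "y \<in> L1" "z \<in> L2" for y z
    using bracket_eq_zero_commute[of z y] that LV by blast
  have sum: "V \<subseteq> {x. \<exists>y\<in>L1. \<exists>z\<in>L2. x = y \<boxplus> z}" (is "_ \<subseteq> ?S")
  proof (rule generated_by_induct[OF generated])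
    have zero: "nul \<in> L1" "nul \<in> L2" using sub unfolding lie_subalgebra_def by blast+
    have S: "x \<in> ?S" if "x = y \<boxplus> z" "y \<in> L1" "z \<in> L2" for x y z using that by blast
    have closed: "p \<boxplus> q \<in> ?S \<and> \<langle>p, q\<rangle> \<in> ?S" if "p \<in> ?S" "q \<in> ?S" for p q
    proof -
      from that obtain p1 p2 q1 q2 where *: "p1 \<in> L1" "p2 \<in> L2" "q1 \<in> L1" "q2 \<in> L2"
        "p = p1 \<boxplus> p2" "q = q1 \<boxplus> q2" by blast
      then have V: "p1 \<in> V" "p2 \<in> V" "q1 \<in> V" "q2 \<in> V" using LV by blast+
      have "p \<boxplus> q = (p1 \<boxplus> q1) \<boxplus> (p2 \<boxplus> q2)" using * V by (simp add: add_add_swap)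
      moreover have "\<langle>p, q\<rangle> = \<langle>p1, q1\<rangle> \<boxplus> \<langle>p2, q2\<rangle>"
        using * V comm comm' by (simp add: bracket_add_left bracket_add_right)
      moreover have "p1 \<boxplus> q1 \<in> L1" "p2 \<boxplus> q2 \<in> L2" "\<langle>p1, q1\<rangle> \<in> L1" "\<langle>p2, q2\<rangle> \<in> L2"
        using * sub unfolding lie_subalgebra_def by simp_all
      ultimately show ?thesis using S by blast
    qed
    have smult: "r \<odot> p \<in> ?S" if "r \<in> carrier R" "p \<in> ?S" for r p
    proof -
      from that obtain p1 p2 where *: "p1 \<in> L1" "p2 \<in> L2" "p = p1 \<boxplus> p2" by blast
      then have "p1 \<in> V" "p2 \<in> V" using LV by blast+
      then have "r \<odot> p = r \<odot> p1 \<boxplus> r \<odot> p2" using * that(1) by (simp add: smult_add_right)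
      moreover have "r \<odot> p1 \<in> L1" "r \<odot> p2 \<in> L2"
        using * sub that(1) unfolding lie_subalgebra_def by simp_all
      ultimately show ?thesis by (rule S)
    qed
    have "?S \<subseteq> V"
    proof
      fix x assume "x \<in> ?S"
      then obtain y z where "y \<in> L1" "z \<in> L2" "x = y \<boxplus> z" by blast
      then show "x \<in> V" using LV by (simp add: subset_iff)
    qed
    moreover have "nul \<in> ?S" by (rule S[OF _ zero]) simp
    ultimately show "lie_subalgebra R L ?S"
      unfolding lie_subalgebra_def using closed smult by (intro conjI ballI) simp_all
    show "\<iota> ` A \<subseteq> ?S"
    proof
      fix x assume "x \<in> \<iota> ` A"
      then have "x \<in> L1 \<or> x \<in> L2" and x: "x \<in> V" using gL BC(5) gens_closed by blast+
      then show "x \<in> ?S" using S[of x x nul] S[of x nul x] zero by (metis add_zero_left add_zero_right)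
    qed
  qed
  have int: "L1 \<inter> L2 = {nul}"
  proof -
    obtain h where h: "lie_hom R L L h" "\<And>c. c \<in> A \<Longrightarrow> h (\<iota> c) = (if c \<in> B then \<iota> c else nul)"
      by (rule universal[where f = "\<lambda>c. if c \<in> B then \<iota> c else nul", OF lie variety_L])
        (simp_all add: gen_bracket)
    have h0: "h nul = nul" by (rule lie_hom_zero[OF lie h(1)])
    have "lie_subalgebra R L {x \<in> V. h x = x}" "lie_subalgebra R L {x \<in> V. h x = nul}"
      using h(1) h0 unfolding lie_subalgebra_def lie_hom_def by simp_all
    moreover have "h (\<iota> c) = \<iota> c" if "c \<in> B" for c
      using h(2)[of c] BC(3) that by auto
    then have "\<iota> ` B \<subseteq> {x \<in> V. h x = x}" using gV(1) by blast
    moreover have "h (\<iota> c) = nul" if "c \<in> C" for c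
      using h(2)[of c] that by (simp add: C_def)
    then have "\<iota> ` C \<subseteq> {x \<in> V. h x = nul}" using gV(2) by blast
    ultimately have "L1 \<subseteq> {x \<in> V. h x = x}" "L2 \<subseteq> {x \<in> V. h x = nul}"
      unfolding L1_def L2_def by (simp_all add: subalgebra_generated_minimal)
    then have "x = nul" if "x \<in> L1 \<inter> L2" for x
      using that by fastforce
    moreover have "nul \<in> L1" "nul \<in> L2" using sub unfolding lie_subalgebra_def by blast+
    ultimately show ?thesis by blast
  qed
  have nonzero: "\<iota> c \<noteq> nul" if "c \<in> A" for c
    using coord_gen[OF that, of c] coord_zero[of c] by auto
  have "direct_sum_decomp R L L1 L2"
    unfolding direct_sum_decomp_def
  proof (intro conjI ballI sub int comm)
    show "\<exists>y\<in>L1. \<exists>z\<in>L2. x = y \<boxplus> z" if "x \<in> V" for x using sum that by blast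
  qed
  moreover have "\<iota> a \<in> L1" "\<iota> b \<in> L2" using gL BC(1,2) by blast+
  then have "L1 \<noteq> {nul}" "L2 \<noteq> {nul}" using nonzero[OF ab(1)] nonzero[OF ab(2)] by blast+
  ultimately show ?thesis by blast
qed

end

theorem theorem3:
  fixes R :: "('r, 'b) ring_scheme"
    and A :: "'v set" and E :: "'v \<Rightarrow> 'v \<Rightarrow> bool"
    and L :: "('r, 'a) liealg" and \<iota> :: "'v \<Rightarrow> 'a" and v :: variety
  assumes "domain R"
    and "finite A" and "card A \<ge> 2"
    and "\<forall>a b. E a b \<longrightarrow> a \<in> A \<and> b \<in> A"
    and "\<forall>a b. E a b \<longrightarrow> E b a"
    and "\<forall>a. \<not> E a a"
    and "v = AllLie \<or> v = Metabelian \<or> (\<exists>m\<ge>2. v = Nilpotent m)"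
    and "pc_lie_algebra R v A E L \<iota>"
  shows "(\<exists>L1 L2. direct_sum_decomp R L L1 L2 \<and> L1 \<noteq> {lzero L} \<and> L2 \<noteq> {lzero L})
         \<longleftrightarrow> \<not> graph_connected A (complement_graph E)"
proof -
  interpret domain R by fact
  have "lie_algebra R L" using assms(8) by (simp add: pc_lie_algebra_def)
  moreover have "A \<noteq> {}" using assms(3) by auto
  ultimately interpret pc_lie_alg R L v A E \<iota>
    using assms by unfold_locales auto
  show ?thesis
    using connected_imp_indecomposable[OF _ _ assms(3)] disconnected_imp_decomposable by blast
qed

end
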